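(* Let $d,m\ge1$ and $0\le p\le m$ be integers with $p+d\ge m$, let $g\in\mathcal{C}([0,1]^d,\mathbb{R}^m)$, and let $W\subseteq\mathbb{R}^m$ be a global $\mathcal{C}^1$ manifold of dimension $p$ (in the sense specified in the context, with associated constant $\gamma_W$). Then for every sufficiently small $\varepsilon>0$ such that $\Psi_g(\gamma_W\cdot\varepsilon)\le\sqrt d$, $$\mathcal{N}^g_W(\varepsilon)\;\le\;C\,\Lambda_\varepsilon\cdot\left(\frac{1}{\Psi_g(\gamma_W\cdot\varepsilon)}\right)^{m-p},\qquad C=2^{d+m-p-1}\,d!\,d^{\,d+\frac{p-m}{2}} .$$
   Context: $|\cdot|$ is the Euclidean norm, $B_m(U,r)=\bigcup_{a\in U}\{x\in\mathbb{R}^m:|x-a|<r\}$ for $U\subseteq\mathbb{R}^m$, and $\mathcal{H}^s$ is the $s$-dimensional Hausdorff measure. Assumption on $W$: for some $r>0$ there is a $\mathcal{C}^1$ diffeomorphism $\varphi:B_m(W,r)\to\varphi(B_m(W,r))\subseteq\mathbb{R}^m$ with $\varphi(W)\subseteq\mathbb{R}^p\times\{0\}\subseteq\mathbb{R}^p\times\mathbb{R}^{m-p}$ and $$0<\lambda_1:=\inf_{x\neq y}\frac{|\varphi(x)-\varphi(y)|}{|x-y|}\le\sup_{x\ne y}\frac{|\varphi(x)-\varphi(y)|}{|x-y|}=:\lambda_2<\infty$$ ($x,y\in B_m(W,r)$). Set $\gamma_W:=\lambda_1/\lambda_2$. For $h\in\mathcal{C}([0,1]^d,\mathbb{R}^m)$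 put $\mathcal{Z}^h_W=\{x\in[0,1]^d:h(x)\in W\}$, and $$\mathcal{N}^g_W(\varepsilon):=\inf\left\{\mathcal{H}^{d+p-m}(\mathcal{Z}^h_W):\ h\in\mathcal{C}([0,1]^d,\mathbb{R}^m),\ \|h-g\|_{\mathcal{C}^0}\le\varepsilon\right\}$$ with $\|\cdot\|_{\mathcal{C}^0}$ the sup norm. Inverse of the minimal modulus of continuity of $g$: for $s\ge0$, $$\Psi_g(s):=\sup\{\delta\ge0:\ |g(x)-g(y)|\le s\ \text{ for all } x,y\in[0,1]^d \text{ with } |x-y|\le\delta\}\in[0,\infty].$$ Set $\ell(s)=\frac{1}{2\sqrt d}\Psi_g(\gamma_W\cdot s)$ for $s>0$. Kolmogorov entropy: for a totally bounded subset $K$ of a metric space $E$ and $\eta>0$, $\mathbf{N}_\eta(K|E)$ is the minimal number of sets in a covering of $K$ by subsets of $E$ of diameter at most $2\eta$, and $\mathbf{H}_\eta(K|E)=\log_2\mathbf{N}_\eta(K|E)$ (so $2^{\mathbf{H}_\eta}=\mathbf{N}_\eta$, which is $0$ for $K=\emptyset$). Finally, $$\Lambda_\varepsilon:=\min\left\{(4\ell(\varepsilon))^d\cdot 2^{\mathbf{H}_{\ell(\varepsilon)}\left(g^{-1}(B_m(\overline W,\varepsilon))\,\big|\,\mathbb{R}^d\right)},\,1\right\},$$ where $g^{-1}(B_m(\overline W,\varepsilon))\subseteq[0,1]^d$. *)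

theory Defs
  imports "HOL-Analysis.Analysis"
begin

subsection \<open>Hausdorff measure\<close>

text \<open>
  The contribution of a covering set is \<open>(diam U)\<^sup>s\<close>, with the usual conventions
  that the empty set contributes \<open>0\<close> and that a one-point set contributes \<open>1\<close> if \<open>s = 0\<close>
  (in HOL, \<open>0 powr 0 = 0\<close>). Boundedness is required separately in the covers because
  \<open>diameter\<close> is an unspecified real number for unbounded sets.

  No normalising factor \<open>\<omega>\<^sub>s / 2\<^sup>s\<close> is used, where \<open>\<omega>\<^sub>s\<close> is the volume of the
  \<open>s\<close>-dimensional unit ball. As this factor is at most \<open>1\<close> for integers \<open>s \<ge> 0\<close>, an upper bound on
  this measure is also an upper bound on the normalised one.
\<close>

definition hausdorff_gauge :: "real \<Rightarrow> 'a::metric_space set \<Rightarrow> real" where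
  "hausdorff_gauge s U = (if U = {} then 0 else if s = 0 then 1 else diameter U powr s)"

definition hausdorff_premeasure :: "real \<Rightarrow> real \<Rightarrow> 'a::metric_space set \<Rightarrow> ennreal" where
  "hausdorff_premeasure s \<delta> A =
     (INF U \<in> {U :: nat \<Rightarrow> 'a set. A \<subseteq> (\<Union>i. U i) \<and> (\<forall>i. bounded (U i) \<and> diameter (U i) \<le> \<delta>)}.
        \<Sum>i. ennreal (hausdorff_gauge s (U i)))"

definition hausdorff_measure :: "real \<Rightarrow> 'a::metric_space set \<Rightarrow> ennreal" where
  "hausdorff_measure s A = (SUP \<delta>\<in>{0<..}. hausdorff_premeasure s \<delta> A)"


subsection \<open>Global \<open>C\<^sup>1\<close> manifolds\<close>

definition tube :: "'a::metric_space set \<Rightarrow> real \<Rightarrow> 'a set" where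
  "tube U r = (\<Union>a\<in>U. ball a r)"

text \<open>Only meaningful for open \<open>S\<close>.\<close>

definition C1_on :: "('a::real_normed_vector \<Rightarrow> 'b::real_normed_vector) \<Rightarrow> 'a set \<Rightarrow> bool" where
  "C1_on f S \<longleftrightarrow>
     (\<exists>f' :: 'a \<Rightarrow> 'a \<Rightarrow>\<^sub>L 'b.
        (\<forall>x\<in>S. (f has_derivative blinfun_apply (f' x)) (at x)) \<and> continuous_on S f')"

definition C1_diffeomorphism_on ::
    "('a::real_normed_vector \<Rightarrow> 'b::real_normed_vector) \<Rightarrow> 'a set \<Rightarrow> bool" where
  "C1_diffeomorphism_on \<phi> S \<longleftrightarrow>
     open S \<and> open (\<phi> ` S) \<and> inj_on \<phi> S \<and> C1_on \<phi> S \<and> C1_on (the_inv_into S \<phi>) (\<phi> ` S)"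

text \<open>
  The index type of \<open>real ^ 'm\<close> is unordered, so the subspace \<open>\<real>\<^sup>p \<times> {0}\<close> is given by the set
  \<open>P\<close> of the \<open>p\<close> coordinates that are not forced to vanish.
\<close>

definition coord_subspace :: "'m::finite set \<Rightarrow> (real ^ 'm) set" where
  "coord_subspace P = {x. \<forall>i. i \<notin> P \<longrightarrow> x $ i = 0}"

definition lower_dilation :: "('a::real_normed_vector \<Rightarrow> 'b::real_normed_vector) \<Rightarrow> 'a set \<Rightarrow> ereal" where
  "lower_dilation \<phi> S =
     (INF (x, y) \<in> {(x, y). x \<in> S \<and> y \<in> S \<and> x \<noteq> y}. ereal (norm (\<phi> x - \<phi> y) / norm (x - y)))"

definition upper_dilation :: "('a::real_normed_vector \<Rightarrow> 'b::real_normed_vector) \<Rightarrow> 'a set \<Rightarrow> ereal" where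
  "upper_dilation \<phi> S =
     (SUP (x, y) \<in> {(x, y). x \<in> S \<and> y \<in> S \<and> x \<noteq> y}. ereal (norm (\<phi> x - \<phi> y) / norm (x - y)))"

text \<open>
  The radius \<open>r\<close> and the chart \<open>\<phi>\<close> are parameters since the constant \<open>\<gamma>\<^sub>W\<close> depends on them.
  The condition on the dilations forces \<open>W\<close> to be nonempty.
\<close>

definition global_C1_manifold ::
    "(real ^ 'm::finite) set \<Rightarrow> nat \<Rightarrow> 'm set \<Rightarrow> real \<Rightarrow> (real ^ 'm \<Rightarrow> real ^ 'm) \<Rightarrow> bool" where
  "global_C1_manifold W p P r \<phi> \<longleftrightarrow>
     card P = p \<and> 0 < r \<and>
     C1_diffeomorphism_on \<phi> (tube W r) \<and>
     \<phi> ` W \<subseteq> coord_subspace P \<and>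
     0 < lower_dilation \<phi> (tube W r) \<and>
     lower_dilation \<phi> (tube W r) \<le> upper_dilation \<phi> (tube W r) \<and>
     upper_dilation \<phi> (tube W r) < \<infinity>"

definition chart_gamma :: "(real ^ 'm::finite) set \<Rightarrow> real \<Rightarrow> (real ^ 'm \<Rightarrow> real ^ 'm) \<Rightarrow> real" where
  "chart_gamma W r \<phi> =
     real_of_ereal (lower_dilation \<phi> (tube W r)) / real_of_ereal (upper_dilation \<phi> (tube W r))"


subsection \<open>Size of preimages under uniform perturbations\<close>

abbreviation unit_cube :: "(real ^ 'd::finite) set" where
  "unit_cube \<equiv> cbox 0 1"

text \<open>Only meaningful for functions that are bounded on the cube, in particular continuous ones.\<close>

definition C0_norm :: "(real ^ 'd::finite \<Rightarrow> real ^ 'm::finite) \<Rightarrow> real" where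
  "C0_norm f = (SUP x\<in>unit_cube. norm (f x))"

definition preimage_set ::
    "(real ^ 'm::finite) set \<Rightarrow> (real ^ 'd::finite \<Rightarrow> real ^ 'm) \<Rightarrow> (real ^ 'd) set" where
  "preimage_set W h = {x \<in> unit_cube. h x \<in> W}"

definition min_preimage_measure ::
    "real \<Rightarrow> (real ^ 'm::finite) set \<Rightarrow> (real ^ 'd::finite \<Rightarrow> real ^ 'm) \<Rightarrow> real \<Rightarrow> ennreal" where
  "min_preimage_measure s W g \<epsilon> =
     (INF h \<in> {h. continuous_on unit_cube h \<and> C0_norm (\<lambda>x. h x - g x) \<le> \<epsilon>}.
        hausdorff_measure s (preimage_set W h))"


subsection \<open>Inverse modulus of continuity and Kolmogorov entropy\<close>

definition inv_modulus :: "(real ^ 'd::finite \<Rightarrow> real ^ 'm::finite) \<Rightarrow> real \<Rightarrow> ennreal" where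
  "inv_modulus g s =
     (SUP \<delta> \<in> {\<delta>. 0 \<le> \<delta> \<and>
        (\<forall>x\<in>unit_cube. \<forall>y\<in>unit_cube. norm (x - y) \<le> \<delta> \<longrightarrow> norm (g x - g y) \<le> s)}. ennreal \<delta>)"

text \<open>The whole type plays the role of the ambient metric space.\<close>

definition covering_number :: "real \<Rightarrow> 'a::metric_space set \<Rightarrow> nat" where
  "covering_number \<eta> K =
     (LEAST n. \<exists>\<C>. finite \<C> \<and> card \<C> = n \<and> K \<subseteq> \<Union>\<C> \<and>
        (\<forall>A\<in>\<C>. bounded A \<and> diameter A \<le> 2 * \<eta>))"

text \<open>
  The empty set has covering number \<open>0\<close> and entropy \<open>-\<infinity>\<close>, so that \<open>2\<close> to the power of the entropy
  is the covering number in all cases; in HOL, \<open>log 2 0 = 0\<close>.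
\<close>

definition kolmogorov_entropy :: "real \<Rightarrow> 'a::metric_space set \<Rightarrow> ereal" where
  "kolmogorov_entropy \<eta> K =
     (if covering_number \<eta> K = 0 then -\<infinity> else ereal (log 2 (real (covering_number \<eta> K))))"

definition two_to :: "ereal \<Rightarrow> real" where
  "two_to h = (if h = -\<infinity> then 0 else 2 powr real_of_ereal h)"

text \<open>\<open>\<gamma>\<close> stands for \<open>\<gamma>\<^sub>W\<close>; these are only used when \<open>inv_modulus g (\<gamma> * \<epsilon>)\<close> is finite.\<close>

definition scale_ell :: "(real ^ 'd::finite \<Rightarrow> real ^ 'm::finite) \<Rightarrow> real \<Rightarrow> real \<Rightarrow> real" where
  "scale_ell g \<gamma> s = 1 / (2 * sqrt (real CARD('d))) * enn2real (inv_modulus g (\<gamma> * s))"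

definition Lambda ::
    "(real ^ 'm::finite) set \<Rightarrow> (real ^ 'd::finite \<Rightarrow> real ^ 'm) \<Rightarrow> real \<Rightarrow> real \<Rightarrow> real" where
  "Lambda W g \<gamma> \<epsilon> =
     min ((4 * scale_ell g \<gamma> \<epsilon>) ^ CARD('d) *
          two_to (kolmogorov_entropy (scale_ell g \<gamma> \<epsilon>)
                    {x \<in> unit_cube. g x \<in> tube (closure W) \<epsilon>}))
         1"

end

theory Submission
  imports Defs "HOL-Combinatorics.Multiset_Permutations"
begin

text \<open>
  Let \<open>k = m - p\<close> and let \<open>f\<close> consist of the last \<open>k\<close> coordinates of \<open>\<phi> \<circ> g\<close>, so that \<open>g\<close> meets \<open>W\<close> where
  \<open>f\<close> vanishes. With \<open>L = \<Psi>\<^sub>g(\<gamma>\<epsilon>)\<close>, cut the cube into \<open>N\<^sup>d\<close> cubes of side \<open>1/N\<close>, \<open>N\<close> being the integer part of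
  \<open>2\<surd>d / L\<close>, and each of them into \<open>d!\<close> simplices, and replace \<open>f\<close> by a function \<open>u\<close> that is affine on every
  simplex. Undoing the chart, and cutting off away from \<open>W\<close>, gives a perturbation \<open>h\<close> of \<open>g\<close> that can
  meet \<open>W\<close> only where \<open>u\<close> vanishes. After a generic small translation of \<open>u\<close>, each simplex contributes
  a subset of an affine subspace of dimension \<open>d - k\<close>, of diameter at most \<open>\<surd>d / N\<close>. Only the
  cubes that meet \<open>g\<^sup>-\<^sup>1(B(W, \<epsilon>))\<close> contribute, and a set of diameter \<open>2\<ell>(\<epsilon>) \<le> 2/N\<close> meets at most \<open>4\<^sup>d\<close> cubes.

  The room for the translation comes from the vertex values of \<open>u\<close>: on a ball of radius \<open>L/2\<close> the values
  of \<open>f\<close> have mutual distances at most \<open>s\<close>, hence lie within \<open>31/32 s\<close> of a common point, whereas the value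
  of \<open>f\<close> at the vertex would only give \<open>s\<close>.
\<close>

subsection \<open>Finite covers and Hausdorff measure\<close>

text \<open>
  The bound \<open>B\<close> does not depend on \<open>\<delta>\<close>, so that finite unions can be handled by concatenating lists,
  without the subadditivity of the Hausdorff measure.
\<close>

definition has_fine_covers :: "real \<Rightarrow> real \<Rightarrow> 'a::metric_space set \<Rightarrow> bool" where
  "has_fine_covers s B A \<longleftrightarrow> (\<forall>\<delta>>0. \<exists>Us. A \<subseteq> \<Union> (set Us) \<and>
     (\<forall>U\<in>set Us. bounded U \<and> diameter U \<le> \<delta>) \<and> sum_list (map (hausdorff_gauge s) Us) \<le> B)"

lemma hausdorff_gauge_nonneg: "0 \<le> hausdorff_gauge s U"
  by (simp add: hausdorff_gauge_def)

lemma hausdorff_gauge_le_power: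
  assumes "bounded U" "diameter U \<le> R" "0 \<le> R"
  shows "hausdorff_gauge (real n) U \<le> R ^ n"
\<comment> \<open>For \<open>n = 0\<close> the gauge of a nonempty set is \<open>1\<close>, whereas
  \<open>powr\<close> would give \<open>0\<close> for a single point.\<close>
proof (cases "n = 0 \<or> U = {}")
  case True
  then show ?thesis using assms by (auto simp: hausdorff_gauge_def)
next
  case False
  then have "diameter U powr real n \<le> R powr real n"
    using assms diameter_ge_0[OF assms(1)] by (intro powr_mono2) auto
  also have "\<dots> \<le> R ^ n"
    using assms False by (cases "R = 0") (auto simp: powr_realpow)
  finally show ?thesis using False by (simp add: hausdorff_gauge_def)
qed

lemma hausdorff_measure_le:
  assumes "has_fine_covers s B A"
  shows "hausdorff_measure s A \<le> ennreal B"
  unfolding hausdorff_measure_def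
proof (rule SUP_least)
  fix \<delta> :: real assume "\<delta> \<in> {0<..}"
  then obtain Us where Us: "A \<subseteq> \<Union> (set Us)" "\<And>U. U \<in> set Us \<Longrightarrow> bounded U \<and> diameter U \<le> \<delta>"
      "sum_list (map (hausdorff_gauge s) Us) \<le> B"
    using assms unfolding has_fine_covers_def by (metis greaterThan_iff)
  \<comment> \<open>The list is padded with empty sets, whose gauge is \<open>0\<close> for every
    \<open>s\<close>, so that the series becomes a finite sum.\<close>
  define U where "U i = (if i < length Us then Us ! i else {})" for i
  have "(\<Sum>i. ennreal (hausdorff_gauge s (U i))) = (\<Sum>i<length Us. ennreal (hausdorff_gauge s (U i)))"
    by (rule suminf_finite) (auto simp: U_def hausdorff_gauge_def)
  also have "\<dots> = ennreal (\<Sum>i<length Us. hausdorff_gauge s (U i))"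
    by (simp add: hausdorff_gauge_nonneg sum_ennreal)
  also have "(\<Sum>i<length Us. hausdorff_gauge s (U i)) = sum_list (map (hausdorff_gauge s) Us)"
    by (simp add: sum_list_sum_nth U_def atLeast0LessThan)
  finally have le: "(\<Sum>i. ennreal (hausdorff_gauge s (U i))) \<le> ennreal B"
    using Us(3) by (simp add: ennreal_leI)
  have "A \<subseteq> (\<Union>i. U i)"
  proof
    fix x assume "x \<in> A"
    then obtain V where "V \<in> set Us" "x \<in> V" using Us(1) by auto
    then obtain i where "i < length Us" "x \<in> Us ! i" by (metis in_set_conv_nth)
    then show "x \<in> (\<Union>i. U i)" by (auto simp: U_def)
  qed
  moreover have "bounded (U i) \<and> diameter (U i) \<le> \<delta>" for i
    using Us(2)[of "Us ! i"] \<open>\<delta> \<in> {0<..}\<close> by (auto simp: U_def)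
  ultimately show "hausdorff_premeasure s \<delta> A \<le> ennreal B"
    unfolding hausdorff_premeasure_def by (intro INF_lower2[where i = U and u = "ennreal B"] le) auto
qed

lemma has_fine_covers_mono:
  assumes "has_fine_covers s B A" "A' \<subseteq> A" "B \<le> B'"
  shows "has_fine_covers s B' A'"
  unfolding has_fine_covers_def
proof (intro allI impI)
  fix \<delta> :: real assume "\<delta> > 0"
  then obtain Us where "A \<subseteq> \<Union> (set Us)" "\<forall>U\<in>set Us. bounded U \<and> diameter U \<le> \<delta>"
      "sum_list (map (hausdorff_gauge s) Us) \<le> B"
    using assms(1) unfolding has_fine_covers_def by meson
  then show "\<exists>Us. A' \<subseteq> \<Union> (set Us) \<and> (\<forall>U\<in>set Us. bounded U \<and> diameter U \<le> \<delta>) \<and>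
      sum_list (map (hausdorff_gauge s) Us) \<le> B'"
    using assms(2,3) by (intro exI[of _ Us]) auto
qed

lemma has_fine_covers_Un:
  assumes "has_fine_covers s B A" "has_fine_covers s B' A'"
  shows "has_fine_covers s (B + B') (A \<union> A')"
  unfolding has_fine_covers_def
proof (intro allI impI)
  fix \<delta> :: real assume "\<delta> > 0"
  then obtain Us Us' where "A \<subseteq> \<Union> (set Us)" "\<forall>U\<in>set Us. bounded U \<and> diameter U \<le> \<delta>"
      "sum_list (map (hausdorff_gauge s) Us) \<le> B"
      "A' \<subseteq> \<Union> (set Us')" "\<forall>U\<in>set Us'. bounded U \<and> diameter U \<le> \<delta>"
      "sum_list (map (hausdorff_gauge s) Us') \<le> B'"
    using assms unfolding has_fine_covers_def by meson
  then show "\<exists>Us. A \<union> A' \<subseteq> \<Union> (set Us) \<and> (\<forall>U\<in>set Us. bounded U \<and> diameter U \<le> \<delta>) \<and>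
      sum_list (map (hausdorff_gauge s) Us) \<le> B + B'"
    by (intro exI[of _ "Us @ Us'"]) auto
qed

lemma has_fine_covers_empty: "has_fine_covers s 0 {}"
  unfolding has_fine_covers_def by (intro allI impI exI[of _ "[]"]) auto

lemma has_fine_covers_UN:
  assumes "finite I" "\<And>i. i \<in> I \<Longrightarrow> has_fine_covers s B (A i)"
  shows "has_fine_covers s (real (card I) * B) (\<Union>i\<in>I. A i)"
  using assms
proof (induction I rule: finite_induct)
  case empty
  then show ?case by (simp add: has_fine_covers_empty)
next
  case (insert i I)
  have "has_fine_covers s (B + real (card I) * B) (A i \<union> (\<Union>i\<in>I. A i))"
    using insert by (intro has_fine_covers_Un) auto
  then show ?case using insert by (simp add: algebra_simps)
qed

section \<open>Covers of pieces of affine subspaces\<close>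

lemma nat_subdivision:
  fixes t D :: real
  assumes "0 \<le> t" "t \<le> D" "0 < q"
  shows "\<exists>j<q. real j * (D / real q) \<le> t \<and> t \<le> real (Suc j) * (D / real q)"
\<comment> \<open>The floor used below would give the right end point the index \<open>q\<close>.
  This case also absorbs \<open>D = 0\<close>.\<close>
proof (cases "t = D")
  case True
  then show ?thesis using assms
    by (intro exI[of _ "q - 1"]) (auto simp: field_simps of_nat_diff)
next
  case False
  then have D: "0 < D" "t < D" using assms by auto
  define j where "j = nat \<lfloor>t * q / D\<rfloor>"
  have nn: "0 \<le> t * q / D" using assms D by auto
  have "t * q / D < q" using D assms by (simp add: field_simps)
  then have "j < q" using nn unfolding j_def by (simp add: nat_less_iff floor_less_iff)
  have "real j = of_int \<lfloor>t * q / D\<rfloor>" using nn by (simp add: j_def)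
  then have "real j \<le> t * q / D" "t * q / D \<le> real (Suc j)" by linarith+
  then have "real j * (D / real q) \<le> t \<and> t \<le> real (Suc j) * (D / real q)"
    using D assms by (simp add: field_simps)
  then show ?thesis using \<open>j < q\<close> by blast
qed

lemma norm_le_of_orthonormal_coords:
  fixes B :: "'a::euclidean_space set"
  assumes "pairwise orthogonal B" "\<And>e. e \<in> B \<Longrightarrow> norm e = 1" "finite B" "v \<in> span B"
    and "\<And>e. e \<in> B \<Longrightarrow> \<bar>v \<bullet> e\<bar> \<le> t"
  shows "norm v \<le> sqrt (card B) * t"
proof (cases "B = {}")
  case True
  then show ?thesis using assms by auto
next
  case False
  then obtain e0 where "e0 \<in> B" by auto
  then have "0 \<le> t" using assms(5)[of e0] by linarith
  have v: "v = (\<Sum>e\<in>B. (v \<bullet> e) *\<^sub>R e)"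
    using assms(1-4) by (simp add: orthonormal_basis_expand)
  have "(norm v)\<^sup>2 = (\<Sum>e\<in>B. (v \<bullet> e)\<^sup>2)"
  proof -
    have "(norm v)\<^sup>2 = v \<bullet> (\<Sum>e\<in>B. (v \<bullet> e) *\<^sub>R e)" using v by (simp add: power2_norm_eq_inner)
    then show ?thesis by (simp add: inner_sum_right power2_eq_square)
  qed
  also have "\<dots> \<le> (\<Sum>e\<in>B. t\<^sup>2)"
    using assms(5) by (intro sum_mono) (metis abs_ge_zero power2_abs power_mono)
  also have "\<dots> = (sqrt (card B) * t)\<^sup>2" by (simp add: power_mult_distrib)
  finally show ?thesis using \<open>0 \<le> t\<close> by (simp add: power2_le_iff_abs_le)
qed

text \<open>In orthonormal coordinates of \<open>K\<close> the set lies in a cube of side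
  \<open>D\<close>. Cutting this cube into \<open>q ^ n\<close> cubes of side \<open>D / q\<close>
  gives pieces of diameter at most \<open>sqrt n * (D / q)\<close>. The total
  \<open>q ^ n * (sqrt n * (D / q)) ^ n\<close> does not depend on \<open>q\<close>, which can
  therefore be as large as the required fineness demands.\<close>

lemma has_fine_covers_affine:
  fixes A :: "'a::euclidean_space set"
  assumes K: "subspace K" "dim K = n"
    and AK: "\<And>x y. x \<in> A \<Longrightarrow> y \<in> A \<Longrightarrow> x - y \<in> K"
    and AD: "\<And>x y. x \<in> A \<Longrightarrow> y \<in> A \<Longrightarrow> norm (x - y) \<le> D" and "0 \<le> D"
  shows "has_fine_covers (real n) ((sqrt n * D) ^ n) A"
proof (cases "A = {}")
  case True
  show ?thesis unfolding True
    by (rule has_fine_covers_mono[OF has_fine_covers_empty]) (use \<open>0 \<le> D\<close> in simp_all)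
next
  case False
  then obtain x0 where x0: "x0 \<in> A" by auto
  obtain B where B: "B \<subseteq> K" "pairwise orthogonal B" "\<And>e. e \<in> B \<Longrightarrow> norm e = 1"
      "independent B" "card B = dim K" "span B = K"
    using orthonormal_basis_subspace[OF K(1)] by metis
  have finB: "finite B" using B(4) independent_imp_finite by blast
  \<comment> \<open>The coordinates of the lower corner of the enclosing cube.\<close>
  define \<beta> where "\<beta> e = (INF x\<in>A. x \<bullet> e)" for e
  have coord: "\<bar>x \<bullet> e - y \<bullet> e\<bar> \<le> D" if "x \<in> A" "y \<in> A" "e \<in> B" for x y e
    using Cauchy_Schwarz_ineq2[of "x - y" e] AD[OF that(1,2)] B(3)[OF that(3)]
    by (simp add: inner_diff_left)
  have \<beta>: "\<beta> e \<le> x \<bullet> e" "x \<bullet> e \<le> \<beta> e + D" if "x \<in> A" "e \<in> B" for x e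
  proof -
    have "y \<bullet> e \<ge> x0 \<bullet> e - D" if "y \<in> A" for y
      using coord[OF that x0 \<open>e \<in> B\<close>] by linarith
    then have bdd: "bdd_below ((\<lambda>x. x \<bullet> e) ` A)" by (intro bdd_belowI2)
    show "\<beta> e \<le> x \<bullet> e" unfolding \<beta>_def using bdd that by (rule_tac cINF_lower)
    have "x \<bullet> e - D \<le> \<beta> e" unfolding \<beta>_def
    proof (rule cINF_greatest[OF False])
      fix y assume "y \<in> A" then show "x \<bullet> e - D \<le> y \<bullet> e" using coord[OF that(1) _ that(2), of y] by linarith
    qed
    then show "x \<bullet> e \<le> \<beta> e + D" by simp
  qed
  show ?thesis unfolding has_fine_covers_def
  proof (intro allI impI)
    fix \<delta> :: real assume \<delta>: "\<delta> > 0"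
    obtain q0 :: nat where q0: "sqrt n * D / \<delta> < real q0" using reals_Archimedean2 by blast
    define q where "q = Suc q0"
    have q: "0 < q" "sqrt n * (D / q) \<le> \<delta>"
    proof -
      have "sqrt n * D / \<delta> < q" using q0 by (simp add: q_def)
      then have "sqrt n * D < q * \<delta>" using \<delta> by (simp add: pos_divide_less_eq)
      then have "sqrt n * D / q \<le> \<delta>"
        by (subst pos_divide_le_eq) (auto simp: q_def mult.commute)
      then show "sqrt n * (D / q) \<le> \<delta>" by simp
    qed (simp add: q_def)
    define U where "U \<kappa> = {x \<in> A. \<forall>e\<in>B. \<beta> e + real (\<kappa> e) * (D / q) \<le> x \<bullet> e \<and>
        x \<bullet> e \<le> \<beta> e + real (Suc (\<kappa> e)) * (D / q)}" for \<kappa> :: "'a \<Rightarrow> nat"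
    have fin: "finite (PiE B (\<lambda>_. {..<q}))" using finB by (intro finite_PiE) auto
    obtain ks where ks: "set ks = PiE B (\<lambda>_. {..<q})" "distinct ks"
      using finite_distinct_list[OF fin] by (elim exE conjE)
    have len: "length ks = q ^ n"
      using distinct_card[OF ks(2)] by (simp add: ks(1) card_PiE finB B(5) K(2))
    have dist: "norm (x - y) \<le> sqrt n * (D / q)" if "x \<in> U \<kappa>" "y \<in> U \<kappa>" for x y \<kappa>
    proof -
      have "\<bar>(x - y) \<bullet> e\<bar> \<le> D / q" if "e \<in> B" for e
      proof -
        have "\<beta> e + real (\<kappa> e) * (D / q) \<le> x \<bullet> e" "x \<bullet> e \<le> \<beta> e + real (Suc (\<kappa> e)) * (D / q)"
          "\<beta> e + real (\<kappa> e) * (D / q) \<le> y \<bullet> e" "y \<bullet> e \<le> \<beta> e + real (Suc (\<kappa> e)) * (D / q)"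
          using \<open>x \<in> U \<kappa>\<close> \<open>y \<in> U \<kappa>\<close> that by (auto simp: U_def)
        then show ?thesis by (simp add: inner_diff_left algebra_simps)
      qed
      moreover have "x - y \<in> span B" using AK that B(6) by (auto simp: U_def)
      ultimately show ?thesis
        using norm_le_of_orthonormal_coords[OF B(2,3) finB] B(5) K(2) by metis
    qed
    have bU: "bounded (U \<kappa>)" "diameter (U \<kappa>) \<le> sqrt n * (D / q)" for \<kappa>
    proof -
      show "bounded (U \<kappa>)"
        using dist unfolding bounded_two_points dist_norm by blast
      show "diameter (U \<kappa>) \<le> sqrt n * (D / q)"
        using dist \<open>0 \<le> D\<close> by (intro diameter_le) auto
    qed
    show "\<exists>Us. A \<subseteq> \<Union> (set Us) \<and> (\<forall>U\<in>set Us. bounded U \<and> diameter U \<le> \<delta>) \<and>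
        sum_list (map (hausdorff_gauge (real n)) Us) \<le> (sqrt n * D) ^ n"
    proof (intro exI[of _ "map U ks"] conjI)
      show "A \<subseteq> \<Union> (set (map U ks))"
      proof
        fix x assume x: "x \<in> A"
        have "\<exists>j<q. real j * (D / q) \<le> x \<bullet> e - \<beta> e \<and> x \<bullet> e - \<beta> e \<le> real (Suc j) * (D / q)"
          if "e \<in> B" for e
          using nat_subdivision[of "x \<bullet> e - \<beta> e" D q] \<beta>[OF x that] q by auto
        then obtain j where j: "\<And>e. e \<in> B \<Longrightarrow> j e < q \<and> real (j e) * (D / q) \<le> x \<bullet> e - \<beta> e \<and>
            x \<bullet> e - \<beta> e \<le> real (Suc (j e)) * (D / q)" by metis
        have "restrict j B \<in> set ks" using j by (auto simp: ks)
        moreover have "x \<in> U (restrict j B)"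
          using x j by (fastforce simp: U_def)
        ultimately show "x \<in> \<Union> (set (map U ks))" by auto
      qed
      show "\<forall>U\<in>set (map U ks). bounded U \<and> diameter U \<le> \<delta>"
        using bU q by (auto intro: order_trans)
      have "sum_list (map (hausdorff_gauge (real n)) (map U ks)) \<le>
          sum_list (map (\<lambda>_. (sqrt n * (D / q)) ^ n) ks)"
        unfolding map_map o_def using bU \<open>0 \<le> D\<close>
        by (intro sum_list_mono hausdorff_gauge_le_power) auto
      also have "\<dots> = (sqrt n * D) ^ n"
        using q(1) by (simp add: sum_list_triv len power_mult_distrib power_divide)
      finally show "sum_list (map (hausdorff_gauge (real n)) (map U ks)) \<le> (sqrt n * D) ^ n" .
    qed
  qed
qed

subsection \<open>Kuhn's triangulation\<close>

text \<open>\<open>None\<close> stands for an additional coordinate with the constant value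
  \<open>0\<close>, so that the maximum and the minimum in \<open>tent\<close> include
  \<open>0\<close> and all comparisons have the same form.\<close>

definition coord0 :: "real ^ 'd::finite \<Rightarrow> 'd option \<Rightarrow> real" where
  "coord0 y p = (case p of None \<Rightarrow> 0 | Some i \<Rightarrow> y $ i)"

text \<open>
  The piecewise affine function that is \<open>1\<close> at \<open>0\<close> and vanishes at all other integer points, with respect
  to Kuhn's triangulation of the integer grid.
\<close>

definition tent :: "real ^ 'd::finite \<Rightarrow> real" where
  "tent y = max 0 (1 - Max (range (coord0 y)) + Min (range (coord0 y)))"

definition int_vec :: "('d::finite \<Rightarrow> int) \<Rightarrow> real ^ 'd" where
  "int_vec v = (\<chi> i. of_int (v i))"

lemma int_vec_nth [simp]: "int_vec v $ i = of_int (v i)"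
  by (simp add: int_vec_def)

definition grid :: "nat \<Rightarrow> ('d::finite \<Rightarrow> int) set" where
  "grid N = {v. \<forall>i. 0 \<le> v i \<and> v i \<le> int N}"

lemma finite_grid: "finite (grid N :: ('d::finite \<Rightarrow> int) set)"
proof -
  have "(grid N :: ('d \<Rightarrow> int) set) = (PiE UNIV (\<lambda>_. {0..int N}))" by (auto simp: grid_def PiE_def Pi_def)
  moreover have "finite (PiE (UNIV :: 'd set) (\<lambda>_. {0..int N}))" by (intro finite_PiE) auto
  ultimately show ?thesis by simp
qed

lemma tent_nonneg: "0 \<le> tent y"
  by (simp add: tent_def)

lemma tent_eq_0:
  assumes "1 \<le> \<bar>y $ i\<bar>"
  shows "tent y = 0"
proof -
  have "coord0 y (Some i) \<le> Max (range (coord0 y))" "coord0 y None \<le> Max (range (coord0 y))"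
    "Min (range (coord0 y)) \<le> coord0 y (Some i)" "Min (range (coord0 y)) \<le> coord0 y None"
    by (auto intro: Max_ge Min_le)
  then show ?thesis using assms by (auto simp: tent_def coord0_def)
qed

text \<open>A vertex that is far from the point in a single coordinate already has a small weight;
  this controls the bad vertices in the interpolation error.\<close>

lemma tent_le: "tent y \<le> max 0 (1 - \<bar>y $ i\<bar>)"
proof -
  have "coord0 y (Some i) \<le> Max (range (coord0 y))" "coord0 y None \<le> Max (range (coord0 y))"
    "Min (range (coord0 y)) \<le> coord0 y (Some i)" "Min (range (coord0 y)) \<le> coord0 y None"
    by (auto intro: Max_ge Min_le)
  then show ?thesis by (auto simp: tent_def coord0_def)
qed

lemma continuous_on_Max_image:
  fixes F :: "'i \<Rightarrow> 'a::topological_space \<Rightarrow> real"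
  assumes "finite I" "I \<noteq> {}" "\<And>i. i \<in> I \<Longrightarrow> continuous_on S (F i)"
  shows "continuous_on S (\<lambda>x. Max ((\<lambda>i. F i x) ` I))"
  using assms
proof (induction I rule: finite_ne_induct)
  case (insert i I)
  then have "continuous_on S (\<lambda>x. max (F i x) (Max ((\<lambda>i. F i x) ` I)))"
    by (intro continuous_on_max) auto
  then show ?case using insert by simp
qed simp

lemma Min_eq_uminus_Max:
  fixes F :: "'i \<Rightarrow> real"
  assumes "finite I" "I \<noteq> {}"
  shows "Min (F ` I) = - Max ((\<lambda>i. - F i) ` I)"
  using minus_Max_eq_Min[of "(\<lambda>i. - F i) ` I"] assms by (simp add: image_image)

lemma continuous_on_tent: "continuous_on UNIV (tent :: real ^ 'd::finite \<Rightarrow> real)"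
proof -
  have c: "continuous_on UNIV (\<lambda>y. coord0 y p)" for p :: "'d option"
    by (cases p) (simp_all add: coord0_def continuous_on_component)
  have "continuous_on UNIV (\<lambda>y :: real^'d. Max ((\<lambda>p. coord0 y p) ` UNIV))"
    by (rule continuous_on_Max_image[OF _ _ c]) simp_all
  moreover have "continuous_on UNIV (\<lambda>y :: real^'d. Max ((\<lambda>p. - coord0 y p) ` UNIV))"
    by (rule continuous_on_Max_image[OF _ _ continuous_on_minus[OF c]]) simp_all
  ultimately have "continuous_on UNIV (\<lambda>y :: real^'d. max 0 (1 - Max ((\<lambda>p. coord0 y p) ` UNIV) +
      - Max ((\<lambda>p. - coord0 y p) ` UNIV)))"
    by (intro continuous_on_max continuous_on_add continuous_on_diff continuous_on_minus
        continuous_on_const)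
  moreover have "tent y = max 0 (1 - Max ((\<lambda>p. coord0 y p) ` UNIV) + - Max ((\<lambda>p. - coord0 y p) ` UNIV))"
    for y :: "real ^ 'd"
    unfolding tent_def by (subst Min_eq_uminus_Max) simp_all
  ultimately show ?thesis by presburger
qed

text \<open>
  Explains why the translates of \<open>tent\<close> form a partition of unity: every \<open>t\<close> picks exactly one vertex of the
  simplex that contains \<open>x\<close>.
\<close>

lemma tent_eq_measure:
  "tent (x - int_vec v) = measure lborel {t. 0 \<le> t \<and> t < 1 \<and> (\<forall>i. \<lceil>x $ i - t\<rceil> = v i)}"
proof -
  let ?c = "coord0 (x - int_vec v)"
  have "{t. 0 \<le> t \<and> t < 1 \<and> (\<forall>i. \<lceil>x $ i - t\<rceil> = v i)} = {Max (range ?c)..<1 + Min (range ?c)}"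
  proof -
    \<comment> \<open>The ceiling condition means \<open>t - 1 < x $ i - v i \<le> t\<close>, and
      \<open>0 \<le> t < 1\<close> is the same condition for the coordinate
      \<open>None\<close>.\<close>
    have "0 \<le> t \<and> t < 1 \<and> (\<forall>i. \<lceil>x $ i - t\<rceil> = v i) \<longleftrightarrow> (\<forall>p. ?c p \<le> t) \<and> (\<forall>p. t - 1 < ?c p)" for t
      by (auto simp: coord0_def ceiling_eq_iff split: option.split) (smt (verit))+
    also have "\<dots> t \<longleftrightarrow> Max (range ?c) \<le> t \<and> t - 1 < Min (range ?c)" for t
      by (subst Max_le_iff, simp, simp, subst Min_gr_iff) auto
    finally show ?thesis by (auto simp: algebra_simps)
  qed
  moreover have "measure lborel {l..<u} = max 0 (u - l)" for l u :: real
    by (cases "l \<le> u") (simp_all add: measure_def)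
  ultimately show ?thesis by (simp add: tent_def add.commute diff_add_eq_diff_diff_swap)
qed

lemma sum_tent:
  assumes "\<And>i. 0 \<le> x $ i \<and> x $ i \<le> real N"
  shows "(\<Sum>v\<in>grid N. tent (x - int_vec v)) = 1"
proof -
  let ?J = "\<lambda>v. {t. 0 \<le> t \<and> t < 1 \<and> (\<forall>i. \<lceil>x $ i - t\<rceil> = v i)}"
  have m: "?J v \<in> sets lborel" for v
    by measurable
  have fin: "emeasure lborel (?J v) \<noteq> \<infinity>" for v
  proof -
    have "emeasure lborel (?J v) \<le> emeasure lborel {0..<1::real}"
      by (intro emeasure_mono) auto
    then show ?thesis by (auto simp: top_unique)
  qed
  have "(\<Sum>v\<in>grid N. tent (x - int_vec v)) = measure lborel (\<Union>v\<in>grid N. ?J v)"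
    unfolding tent_eq_measure using m fin
    by (intro measure_finite_Union[symmetric] finite_grid)
      (auto simp: disjoint_family_on_def fun_eq_iff)
  also have "(\<Union>v\<in>grid N. ?J v) = {0..<1}"
  proof -
    \<comment> \<open>Since \<open>t < 1\<close>, the numbers \<open>x $ i - t\<close> stay above
      \<open>-1\<close>, so their ceilings are at least \<open>0\<close> and the chosen vertex does
      not leave the grid.\<close>
    have "(\<lambda>i. \<lceil>x $ i - t\<rceil>) \<in> grid N" if t: "0 \<le> t" "t < 1" for t
    proof -
      have "-1 < x $ i - t \<and> x $ i - t \<le> real N" for i using assms[of i] t by linarith
      then show ?thesis by (auto simp: grid_def le_ceiling_iff ceiling_le_iff)
    qed
    then have "t \<in> (\<Union>v\<in>grid N. ?J v)" if "t \<in> {0..<1}" for t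
      using that by (intro UN_I[of "\<lambda>i. \<lceil>x $ i - t\<rceil>"]) auto
    then show ?thesis by auto
  qed
  finally show ?thesis by simp
qed

section \<open>Simplices, and the affinity of the tents on them\<close>

definition affine_map_on :: "(real ^ 'd::finite) set \<Rightarrow> (real ^ 'd \<Rightarrow> real) \<Rightarrow> bool" where
  "affine_map_on T F \<longleftrightarrow> (\<exists>a b. \<forall>x\<in>T. F x = a \<bullet> x + b)"

text \<open>For an enumeration \<open>xs\<close> of the coordinates this is one of the simplices of
  Kuhn's triangulation of the unit cube with lower corner \<open>z\<close>: \<open>xs\<close> lists
  the coordinates in increasing order of the position inside the cube.\<close>

definition kuhn_cell :: "('d::finite \<Rightarrow> int) \<Rightarrow> 'd list \<Rightarrow> (real ^ 'd) set" where
  "kuhn_cell z xs = {x. (\<forall>i. of_int (z i) \<le> x $ i \<and> x $ i \<le> of_int (z i) + 1) \<and>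
     sorted (map (\<lambda>i. x $ i - of_int (z i)) xs)}"

text \<open>
  Such a difference is an integer plus \<open>w\<^sub>p - w\<^sub>q \<in> [-1, 1]\<close>, where \<open>w\<close> is the position relative to the corner \<open>z\<close>,
  and the order of the \<open>w\<^sub>p\<close> is constant on the cell. Hence all case distinctions in the definition
  of \<open>tent\<close> have the same outcome on the whole cell.
\<close>

lemma coord0_diff_sign:
  fixes z v :: "'d::finite \<Rightarrow> int"
  assumes "set xs = UNIV"
  shows "(\<forall>x\<in>kuhn_cell z xs. coord0 (x - int_vec v) p - coord0 (x - int_vec v) q \<le> of_int k) \<or>
         (\<forall>x\<in>kuhn_cell z xs. of_int k \<le> coord0 (x - int_vec v) p - coord0 (x - int_vec v) q)"
proof -
  define w where "w x p = (case p of None \<Rightarrow> 0 | Some i \<Rightarrow> x $ i - of_int (z i))" for x :: "real^'d" and p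
  define b where "b p = (case p of None \<Rightarrow> 0 | Some i \<Rightarrow> z i - v i)" for p
  have eq: "coord0 (x - int_vec v) p = of_int (b p) + w x p" for x p
    by (simp add: coord0_def w_def b_def split: option.split)
  have w01: "0 \<le> w x p" "w x p \<le> 1" if "x \<in> kuhn_cell z xs" for x p
    using that by (auto simp: w_def kuhn_cell_def algebra_simps split: option.split)
  have ord: "(\<forall>x\<in>kuhn_cell z xs. w x p \<le> w x q) \<or> (\<forall>x\<in>kuhn_cell z xs. w x q \<le> w x p)" for p q
  proof (cases "p = None \<or> q = None")
    case True
    then show ?thesis using w01 by (auto simp: w_def)
  next
    case False
    then obtain i j where ij: "p = Some i" "q = Some j" by auto
    obtain i' j' where i': "i' < length xs" "xs ! i' = i" and j': "j' < length xs" "xs ! j' = j"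
      using assms by (metis UNIV_I in_set_conv_nth)
    show ?thesis
    proof (cases "i' \<le> j'")
      case True
      then have "w x p \<le> w x q" if "x \<in> kuhn_cell z xs" for x
        using that i' j' sorted_nth_mono[of "map (\<lambda>i. x $ i - of_int (z i)) xs" i' j']
        by (auto simp: kuhn_cell_def w_def ij)
      then show ?thesis by blast
    next
      case False
      then have "w x q \<le> w x p" if "x \<in> kuhn_cell z xs" for x
        using that i' j' sorted_nth_mono[of "map (\<lambda>i. x $ i - of_int (z i)) xs" j' i']
        by (auto simp: kuhn_cell_def w_def ij)
      then show ?thesis by blast
    qed
  qed
  show ?thesis
  proof (cases "\<forall>x\<in>kuhn_cell z xs. w x p \<le> w x q")
    case True
    show ?thesis
    \<comment> \<open>Here the difference stays between \<open>b p - b q - 1\<close> and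
      \<open>b p - b q\<close> on the whole cell, and no integer lies strictly between these
      two.\<close>
    proof (cases "b p - b q \<le> k")
      case le: True
      have "coord0 (x - int_vec v) p - coord0 (x - int_vec v) q \<le> of_int k" if "x \<in> kuhn_cell z xs" for x
      proof -
        have "real_of_int (b p - b q) \<le> of_int k" using le by linarith
        moreover have "w x p \<le> w x q" using True that by blast
        ultimately show ?thesis by (simp add: eq)
      qed
      then show ?thesis by blast
    next
      case ge: False
      have "of_int k \<le> coord0 (x - int_vec v) p - coord0 (x - int_vec v) q" if "x \<in> kuhn_cell z xs" for x
      proof -
        have "real_of_int k \<le> of_int (b p - b q - 1)" using ge by linarith
        then show ?thesis using w01(1)[OF that, of p] w01(2)[OF that, of q] by (simp add: eq)
      qed
      then show ?thesis by blast
    qed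
  next
    case False
    then have qp: "\<And>x. x \<in> kuhn_cell z xs \<Longrightarrow> w x q \<le> w x p" using ord by blast
    show ?thesis
    proof (cases "k \<le> b p - b q")
      case le: True
      have "of_int k \<le> coord0 (x - int_vec v) p - coord0 (x - int_vec v) q" if "x \<in> kuhn_cell z xs" for x
      proof -
        have "real_of_int k \<le> of_int (b p - b q)" using le by linarith
        then show ?thesis using qp[OF that] by (simp add: eq)
      qed
      then show ?thesis by blast
    next
      case ge: False
      have "coord0 (x - int_vec v) p - coord0 (x - int_vec v) q \<le> of_int k" if "x \<in> kuhn_cell z xs" for x
      proof -
        have "real_of_int (b p - b q + 1) \<le> of_int k" using ge by linarith
        then show ?thesis using w01(2)[OF that, of p] w01(1)[OF that, of q] by (simp add: eq)
      qed
      then show ?thesis by blast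
    qed
  qed
qed

text \<open>Makes the maximum in \<open>tent\<close> a single coordinate function on a whole cell
  and, with reversed signs, the minimum as well.\<close>

lemma ex_dominating:
  fixes F :: "'p \<Rightarrow> 'a \<Rightarrow> real"
  assumes "finite I" "I \<noteq> {}"
    and "\<And>p q. p \<in> I \<Longrightarrow> q \<in> I \<Longrightarrow> (\<forall>x\<in>T. F p x \<le> F q x) \<or> (\<forall>x\<in>T. F q x \<le> F p x)"
  shows "\<exists>p\<in>I. \<forall>q\<in>I. \<forall>x\<in>T. F q x \<le> F p x"
  using assms
proof (induction I rule: finite_ne_induct)
  case (insert i I)
  then obtain p where p: "p \<in> I" "\<forall>q\<in>I. \<forall>x\<in>T. F q x \<le> F p x" by blast
  have "(\<forall>x\<in>T. F p x \<le> F i x) \<or> (\<forall>x\<in>T. F i x \<le> F p x)" using insert.prems p(1) by blast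
  then show ?case
  proof
    assume "\<forall>x\<in>T. F p x \<le> F i x"
    then show ?thesis using p by (intro bexI[of _ i]) (auto intro: order_trans)
  next
    assume "\<forall>x\<in>T. F i x \<le> F p x"
    then show ?thesis using p by blast
  qed
qed auto

lemma tent_affine_on_cell:
  fixes z v :: "'d::finite \<Rightarrow> int"
  assumes "set xs = UNIV"
  shows "affine_map_on (kuhn_cell z xs) (\<lambda>x. tent (x - int_vec v))"
proof -
  let ?T = "kuhn_cell z xs"
  let ?F = "\<lambda>p x. coord0 (x - int_vec v) p"
  have sgn: "(\<forall>x\<in>?T. ?F p x - ?F q x \<le> of_int k) \<or> (\<forall>x\<in>?T. of_int k \<le> ?F p x - ?F q x)" for p q k
    using coord0_diff_sign[OF assms] .
  have cmp: "(\<forall>x\<in>?T. ?F p x \<le> ?F q x) \<or> (\<forall>x\<in>?T. ?F q x \<le> ?F p x)" for p q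
    using sgn[of p q 0] by auto
  obtain p where p: "\<And>q x. x \<in> ?T \<Longrightarrow> ?F q x \<le> ?F p x"
    using ex_dominating[of UNIV ?T ?F] cmp by (metis (no_types, lifting) UNIV_I UNIV_not_empty finite)
  obtain q where q: "\<And>p x. x \<in> ?T \<Longrightarrow> ?F q x \<le> ?F p x"
    using ex_dominating[of UNIV ?T "\<lambda>p x. - ?F p x"] cmp
    by (metis (no_types, lifting) UNIV_I UNIV_not_empty finite neg_le_iff_le)
  have Mx: "Max (range (coord0 (x - int_vec v))) = ?F p x" if "x \<in> ?T" for x
    using p[OF that] by (intro Max_eqI) auto
  have Mn: "Min (range (coord0 (x - int_vec v))) = ?F q x" if "x \<in> ?T" for x
    using q[OF that] by (intro Min_eqI) auto
  have aff: "\<exists>a b. \<forall>x. ?F p x = a \<bullet> x + b" for p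
  proof (cases p)
    case None
    then show ?thesis by (intro exI[of _ 0]) (auto simp: coord0_def)
  next
    case (Some i)
    have "?F p x = axis i 1 \<bullet> x + - of_int (v i)" for x
      by (simp add: Some coord0_def inner_axis')
    then show ?thesis by blast
  qed
  obtain a b where ab: "\<And>x. ?F p x = a \<bullet> x + b" using aff by blast
  obtain a' b' where ab': "\<And>x. ?F q x = a' \<bullet> x + b'" using aff by blast
  show ?thesis
  \<comment> \<open>The truncation at \<open>0\<close> is also decided uniformly on the cell, by
    \<open>coord0_diff_sign\<close> with \<open>k = 1\<close>.\<close>
  proof (cases "\<forall>x\<in>?T. ?F p x - ?F q x \<le> 1")
    case True
    then have "\<forall>x\<in>?T. tent (x - int_vec v) = (a' - a) \<bullet> x + (1 - b + b')"
      by (auto simp: tent_def Mx Mn ab ab' inner_diff_left)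
    then show ?thesis unfolding affine_map_on_def by blast
  next
    case False
    then have "\<forall>x\<in>?T. 1 \<le> ?F p x - ?F q x" using sgn[of p q 1] by auto
    then have "\<forall>x\<in>?T. tent (x - int_vec v) = 0 \<bullet> x + 0"
      by (auto simp: tent_def Mx Mn)
    then show ?thesis unfolding affine_map_on_def by blast
  qed
qed

lemma in_kuhn_cell:
  fixes x :: "real ^ 'd::finite"
  assumes "0 < N" and x: "\<And>i. 0 \<le> x $ i \<and> x $ i \<le> real N"
  shows "\<exists>z. (\<forall>i. 0 \<le> z i \<and> z i < int N) \<and> (\<exists>xs\<in>permutations_of_set UNIV. x \<in> kuhn_cell z xs)"
proof -
  \<comment> \<open>On the face \<open>x $ i = N\<close> the floor would give a cube outside the
    grid; the minimum selects the last cube instead.\<close>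
  define z where "z i = min \<lfloor>x $ i\<rfloor> (int N - 1)" for i
  have z: "0 \<le> z i" "z i < int N" "of_int (z i) \<le> x $ i" "x $ i \<le> of_int (z i) + 1" for i
    using assms(1) x[of i] by (auto simp: z_def min_def) linarith+
  obtain ys :: "'d list" where ys: "set ys = UNIV" "distinct ys"
    using finite_distinct_list[of "UNIV :: 'd set"] by auto
  define xs where "xs = sort_key (\<lambda>i. x $ i - of_int (z i)) ys"
  have "xs \<in> permutations_of_set UNIV"
    using ys by (auto simp: xs_def permutations_of_set_def)
  moreover have "x \<in> kuhn_cell z xs"
    using z by (auto simp: kuhn_cell_def xs_def)
  ultimately show ?thesis using z by blast
qed

subsection \<open>Generic level sets of piecewise affine interpolations\<close>

text \<open>Rank-nullity: \<open>A\<close> is injective on the orthogonal complement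
  \<open>M\<close> of its kernel and maps it onto the range.\<close>

lemma dim_kernel:
  fixes A :: "'a::euclidean_space \<Rightarrow> 'b::euclidean_space"
  assumes "linear A"
  shows "dim {x. A x = 0} + dim (range A) = DIM('a)"
proof -
  let ?K = "{x. A x = 0}"
  have sK: "subspace ?K" by (rule linear_subspace_kernel[OF assms])
  define M where "M = {y. \<forall>x\<in>?K. orthogonal x y}"
  have sM: "subspace M" unfolding M_def by (rule subspace_orthogonal_to_vectors)
  have dims: "dim M + dim ?K = DIM('a)"
    using dim_subspace_orthogonal_to_vectors[OF sK subspace_UNIV] by (simp add: M_def)
  have "inj_on A (span M)"
  proof (rule inj_onI)
    fix x y assume "x \<in> span M" "y \<in> span M" "A x = A y"
    moreover have "span M = M" by (rule sM[folded span_eq_iff])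
    ultimately have "x - y \<in> M" "x - y \<in> ?K"
      using subspace_diff[OF sM] linear_diff[OF assms] by auto
    then have "orthogonal (x - y) (x - y)" unfolding M_def by blast
    then show "x = y" by (simp add: orthogonal_self)
  qed
  then have "dim (A ` M) = dim M" using dim_image_eq[OF assms] by blast
  moreover have "range A = A ` M"
  proof -
    have "A x \<in> A ` M" for x
    proof -
      obtain y z where yz: "y \<in> span ?K" "\<And>w. w \<in> span ?K \<Longrightarrow> orthogonal z w" "x = y + z"
        using orthogonal_subspace_decomp_exists by blast
      have "span ?K = ?K" by (rule sK[folded span_eq_iff])
      then have "y \<in> ?K" using yz(1) by (simp only:)
      then have "A y = 0" by simp
      then have "A x = A z" using yz(3) linear_add[OF assms] by simp
      moreover have "z \<in> M" using yz(2) by (auto simp: M_def orthogonal_commute intro: span_base)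
      ultimately show ?thesis by blast
    qed
    then show ?thesis by blast
  qed
  ultimately show ?thesis using dims by simp
qed

text \<open>All pieces take their values in \<open>range q\<close>. A piece whose linear part is
  onto \<open>range q\<close> has a kernel of the expected dimension, by rank-nullity. A piece that
  is not onto has its values in a proper affine subspace of \<open>range q\<close>, which a generic
  \<open>y\<close> avoids, for finitely many pieces at once.\<close>

lemma generic_shift:
  fixes A :: "'i \<Rightarrow> 'a::euclidean_space \<Rightarrow> 'b::euclidean_space"
  assumes q: "linear q" "\<And>y. q (q y) = q y" "\<And>y. norm (q y) \<le> norm y"
    and I: "finite I" "\<And>i. i \<in> I \<Longrightarrow> linear (A i)" "\<And>i x. i \<in> I \<Longrightarrow> q (A i x) = A i x"
      "\<And>i. i \<in> I \<Longrightarrow> q (b i) = b i"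
    and \<eta>: "\<eta> > 0"
  shows "\<exists>y. q y = y \<and> norm y < \<eta> \<and>
    (\<forall>i\<in>I. (\<forall>x. A i x + b i \<noteq> y) \<or> dim {x. A i x = 0} + dim (range q) = DIM('a))"
proof -
  \<comment> \<open>The translation is sought as \<open>q w\<close> with \<open>w\<close> in a ball
    of the whole space, where Lebesgue null sets are available. As \<open>q\<close> does not
    increase norms, \<open>q w\<close> is as small as required.\<close>
  define bad where "bad i = {w. q w - b i \<in> range (A i)}" for i
  have neg: "negligible (bad i)" if i: "i \<in> I" "range (A i) \<noteq> range q" for i
  proof -
    define M where "M = {w. q w \<in> range (A i)}"
    have sM: "subspace M" unfolding M_def
      using linear_subspace_vimage[OF q(1) linear_subspace_image[OF I(2)[OF i(1)] subspace_UNIV]]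
      by (simp add: vimage_def)
    have "M \<noteq> UNIV"
    proof
      assume "M = UNIV"
      then have "range q \<subseteq> range (A i)" by (auto simp: M_def)
      moreover have "range (A i) \<subseteq> range q" using I(3)[OF i(1)] by (metis image_subsetI rangeI)
      ultimately show False using i(2) by simp
    qed
    then have "dim M < DIM('b)"
      proof -
      have "span M \<noteq> UNIV" using \<open>M \<noteq> UNIV\<close> sM by (metis span_eq_iff)
      then show ?thesis using dim_eq_full[of M] dim_subset_UNIV[of M] by linarith
    qed
    then have "negligible ((+) (b i) ` M)" by (intro negligible_translation negligible_lowdim)
    moreover have "bad i \<subseteq> (+) (b i) ` M"
    proof
      fix w assume "w \<in> bad i"
      then have "q (w - b i) \<in> range (A i)" by (simp add: bad_def linear_diff[OF q(1)] I(4)[OF i(1)])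
      then show "w \<in> (+) (b i) ` M" by (intro image_eqI[of _ _ "w - b i"]) (auto simp: M_def)
    qed
    ultimately show ?thesis by (rule negligible_subset)
  qed
  have "negligible (\<Union>i\<in>{i\<in>I. range (A i) \<noteq> range q}. bad i)"
  proof (rule negligible_Union)
    fix t assume "t \<in> bad ` {i\<in>I. range (A i) \<noteq> range q}"
    then show "negligible t" using neg by blast
  qed (use I(1) in simp)
  moreover have "\<not> negligible (ball (0::'b) \<eta>)"
    using \<eta> by (intro open_not_negligible) auto
  ultimately have "\<not> ball 0 \<eta> \<subseteq> (\<Union>i\<in>{i\<in>I. range (A i) \<noteq> range q}. bad i)"
    by (metis negligible_subset)
  then obtain w where w: "w \<in> ball 0 \<eta>" "w \<notin> (\<Union>i\<in>{i\<in>I. range (A i) \<noteq> range q}. bad i)"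
    by (meson subsetI)
  show ?thesis
  proof (intro exI[of _ "q w"] conjI ballI)
    show "q (q w) = q w" by (rule q)
    show "norm (q w) < \<eta>" using w(1) q(3)[of w] by (auto intro: le_less_trans)
    fix i assume i: "i \<in> I"
    show "(\<forall>x. A i x + b i \<noteq> q w) \<or> dim {x. A i x = 0} + dim (range q) = DIM('a)"
    proof (cases "range (A i) = range q")
      case True
      then show ?thesis using dim_kernel[OF I(2)[OF i]] by simp
    next
      case False
      then have "w \<notin> bad i" using w(2) i by blast
      then show ?thesis by (auto simp: bad_def) (metis add_diff_cancel_right' rangeI)
    qed
  qed
qed

text \<open>
  The midpoint of a pair at distance at least \<open>s / 2\<close> works, by the parallelogram law; without such a pair
  any point does. The constant only matters for being less than \<open>1\<close>.
\<close>

lemma near_center: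
  fixes S :: "'a::real_inner set"
  assumes "S \<noteq> {}" "\<And>x y. x \<in> S \<Longrightarrow> y \<in> S \<Longrightarrow> norm (x - y) \<le> s"
  shows "\<exists>c\<in>convex hull S. \<forall>x\<in>S. norm (x - c) \<le> 31 / 32 * s"
proof (cases "\<exists>a\<in>S. \<exists>b\<in>S. s / 2 \<le> norm (a - b)")
  case True
  then obtain a b where ab: "a \<in> S" "b \<in> S" "s / 2 \<le> norm (a - b)" by auto
  have s: "0 \<le> s" using assms(2)[OF ab(1,1)] by simp
  have "norm (x - midpoint a b) \<le> 31 / 32 * s" if x: "x \<in> S" for x
  proof -
    have eq: "(norm (x - midpoint a b))\<^sup>2 =
        ((norm (x - a))\<^sup>2 + (norm (x - b))\<^sup>2) / 2 - (norm (a - b))\<^sup>2 / 4"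
      unfolding midpoint_def power2_norm_eq_inner
      by (simp add: inner_diff_left inner_diff_right inner_add_left inner_add_right
          inner_commute field_simps)
    have "(norm (x - a))\<^sup>2 \<le> s\<^sup>2" "(norm (x - b))\<^sup>2 \<le> s\<^sup>2"
      using assms(2)[OF x] ab by (auto intro: power_mono)
    moreover have "s\<^sup>2 \<le> (2 * norm (a - b))\<^sup>2"
      using ab(3) s by (intro power_mono) auto
    then have "s\<^sup>2 \<le> 4 * (norm (a - b))\<^sup>2"
      by (simp add: power_mult_distrib)
    \<comment> \<open>The factor \<open>15 / 16\<close> comes from
      \<open>s\<^sup>2 - (s / 2)\<^sup>2 / 4\<close>, and \<open>31 / 32\<close> is a rational upper
      bound for its square root.\<close>
    moreover have "(15 / 16) * s\<^sup>2 \<le> (31 / 32 * s)\<^sup>2"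
      by (simp add: power2_eq_square)
    moreover have "(X + Y) / 2 - Z / 4 \<le> T" if "X \<le> S" "Y \<le> S" "S \<le> 4 * Z" "15 / 16 * S \<le> T"
      for X Y Z S T :: real
      using that by (simp add: field_simps)
    ultimately have "(norm (x - midpoint a b))\<^sup>2 \<le> (31 / 32 * s)\<^sup>2"
      unfolding eq by blast
    then show ?thesis using s by (simp add: power2_le_iff_abs_le)
  qed
  moreover have "midpoint a b \<in> convex hull S"
    using ab midpoint_in_closed_segment[of a b] segment_convex_hull[of a b]
      hull_mono[of "{a, b}" S convex] by auto
  ultimately show ?thesis by blast
next
  case False
  obtain a where a: "a \<in> S" using assms by auto
  have "norm (x - a) \<le> 31 / 32 * s" if "x \<in> S" for x
    using False a that assms(2)[OF a a] by fastforce
  then show ?thesis using a hull_inc[of a S] by blast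
qed

section \<open>Piecewise affine interpolation of the values \<open>c v\<close> at the grid points of
  mesh \<open>1 / N\<close>\<close>

definition grid_interp :: "nat \<Rightarrow> (('d::finite \<Rightarrow> int) \<Rightarrow> 'b::real_normed_vector) \<Rightarrow> real ^ 'd \<Rightarrow> 'b" where
  "grid_interp N c x = (\<Sum>v\<in>grid N. tent (real N *\<^sub>R x - int_vec v) *\<^sub>R c v)"

lemma continuous_on_grid_interp: "continuous_on S (grid_interp N c)"
proof -
  have "continuous_on S (\<lambda>x. tent (real N *\<^sub>R x - int_vec v))" for v
    by (rule continuous_on_compose2[OF continuous_on_tent]) (auto intro!: continuous_intros)
  then show ?thesis
    unfolding grid_interp_def by (intro continuous_intros)
qed

text \<open>Invariance under \<open>q\<close> passes from the vertex values to both parts of the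
  affine map, as \<open>generic_shift\<close> requires.\<close>

lemma grid_interp_affine:
  fixes c :: "('d::finite \<Rightarrow> int) \<Rightarrow> 'b::euclidean_space"
  assumes q: "linear q" "\<And>v. q (c v) = c v" and xs: "set xs = UNIV"
  shows "\<exists>A b. linear A \<and> (\<forall>x. q (A x) = A x) \<and> q b = b \<and>
    (\<forall>x. real N *\<^sub>R x \<in> kuhn_cell z xs \<longrightarrow> grid_interp N c x = A x + b)"
proof -
  have "\<exists>a b. \<forall>x\<in>kuhn_cell z xs. tent (x - int_vec v) = a \<bullet> x + b" for v
    using tent_affine_on_cell[OF xs] by (simp add: affine_map_on_def)
  then obtain a b where ab: "\<And>v x. x \<in> kuhn_cell z xs \<Longrightarrow> tent (x - int_vec v) = a v \<bullet> x + b v"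
    by metis
  define A where "A x = (\<Sum>v\<in>grid N. (real N * (a v \<bullet> x)) *\<^sub>R c v)" for x
  define B where "B = (\<Sum>v\<in>grid N. b v *\<^sub>R c v)"
  have "linear A"
    by (rule linearI) (simp_all add: A_def inner_add_right algebra_simps sum.distrib scaleR_sum_right)
  moreover have "q (A x) = A x" for x
    unfolding A_def by (simp add: linear_sum[OF q(1)] linear_cmul[OF q(1)] q(2))
  moreover have "q B = B"
    unfolding B_def by (simp add: linear_sum[OF q(1)] linear_cmul[OF q(1)] q(2))
  moreover have "grid_interp N c x = A x + B" if "real N *\<^sub>R x \<in> kuhn_cell z xs" for x
    using ab[OF that] by (simp add: grid_interp_def A_def B_def scaleR_left_distrib sum.distrib)
  ultimately show ?thesis by blast
qed

lemma mem_unit_cube_iff: "x \<in> unit_cube \<longleftrightarrow> (\<forall>i. 0 \<le> x $ i \<and> x $ i \<le> 1)"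
  for x :: "real ^ 'd::finite"
  by (auto simp: mem_box_cart)

lemma norm_le_sqrt_card:
  fixes x :: "real ^ 'd::finite"
  assumes "\<And>i. \<bar>x $ i\<bar> \<le> t" "0 \<le> t"
  shows "norm x \<le> sqrt CARD('d) * t"
proof -
  have "(norm x)\<^sup>2 = (\<Sum>i\<in>UNIV. (x $ i)\<^sup>2)"
    by (simp add: norm_vec_def L2_set_def sum_nonneg)
  also have "\<dots> \<le> (\<Sum>i\<in>(UNIV::'d set). t\<^sup>2)"
    using assms by (intro sum_mono) (metis abs_ge_zero power2_abs power_mono)
  also have "\<dots> = (sqrt CARD('d) * t)\<^sup>2" by (simp add: power_mult_distrib)
  finally show ?thesis using assms(2) by (simp add: power2_le_iff_abs_le)
qed

text \<open>A nonzero weight leaves only two integers for each coordinate of the vertex.\<close>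

lemma card_tent_support:
  fixes x :: "real ^ 'd::finite"
  shows "card {v\<in>grid N. tent (x - int_vec v) \<noteq> 0} \<le> 2 ^ CARD('d)"
proof -
  let ?S = "{v\<in>grid N. tent (x - int_vec v) \<noteq> 0}"
  have "?S \<subseteq> PiE UNIV (\<lambda>i. {\<lfloor>x $ i\<rfloor>, \<lfloor>x $ i\<rfloor> + 1})"
  proof
    fix v assume v: "v \<in> ?S"
    have "v i \<in> {\<lfloor>x $ i\<rfloor>, \<lfloor>x $ i\<rfloor> + 1}" for i
    proof -
      have "\<bar>x $ i - of_int (v i)\<bar> < 1" using v tent_eq_0[of "x - int_vec v" i] by force
      then have "v i = \<lfloor>x $ i\<rfloor> \<or> v i = \<lfloor>x $ i\<rfloor> + 1" by linarith
      then show ?thesis by simp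
    qed
    then show "v \<in> PiE UNIV (\<lambda>i. {\<lfloor>x $ i\<rfloor>, \<lfloor>x $ i\<rfloor> + 1})" by auto
  qed
  moreover have "finite (PiE UNIV (\<lambda>i. {\<lfloor>x $ i\<rfloor>, \<lfloor>x $ i\<rfloor> + 1}))" by (intro finite_PiE) auto
  ultimately have "card ?S \<le> card (PiE UNIV (\<lambda>i. {\<lfloor>x $ i\<rfloor>, \<lfloor>x $ i\<rfloor> + 1}))"
    by (rule card_mono[rotated])
  also have "\<dots> = 2 ^ CARD('d)" by (simp add: card_PiE numeral_2_eq_2)
  finally show ?thesis .
qed

text \<open>
  Vertices at which the estimate with \<open>\<kappa>\<close> fails are so far from \<open>x\<close> that their weight is at most \<open>\<tau>\<close>.
\<close>

lemma grid_interp_approx: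
  fixes x :: "real ^ 'd::finite" and y :: "'b::real_normed_vector"
  assumes x: "x \<in> unit_cube" and s: "0 \<le> s"
    and near: "\<And>v. v \<in> grid N \<Longrightarrow> (\<And>i. \<bar>real N * x $ i - of_int (v i)\<bar> \<le> 1 - \<tau>) \<Longrightarrow> norm (c v - y) \<le> \<kappa> * s"
    and far: "\<And>v. v \<in> grid N \<Longrightarrow> (\<And>i. \<bar>real N * x $ i - of_int (v i)\<bar> < 1) \<Longrightarrow> norm (c v - y) \<le> 2 * s"
    and \<tau>: "0 \<le> \<tau>" and \<kappa>: "0 \<le> \<kappa>"
  shows "norm (grid_interp N c x - y) \<le> (\<kappa> + 2 ^ CARD('d) * (2 * \<tau>)) * s"
proof -
  let ?t = "\<lambda>v. tent (real N *\<^sub>R x - int_vec v)"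
  let ?S = "{v\<in>grid N. ?t v \<noteq> 0}"
  have sum1: "(\<Sum>v\<in>grid N. ?t v) = 1"
    using x by (intro sum_tent) (auto simp: mem_unit_cube_iff intro: mult_left_le)
  have S: "sum g ?S = sum g (grid N)" if "\<And>v. ?t v = 0 \<Longrightarrow> g v = 0" for g :: "('d \<Rightarrow> int) \<Rightarrow> real"
    using that by (intro sum.mono_neutral_left finite_grid) auto
  have le: "?t v * norm (c v - y) \<le> ?t v * (\<kappa> * s) + \<tau> * (2 * s)" if v: "v \<in> ?S" for v
  proof (cases "\<forall>i. \<bar>real N * x $ i - of_int (v i)\<bar> \<le> 1 - \<tau>")
    case True
    then have "?t v * norm (c v - y) \<le> ?t v * (\<kappa> * s)"
      using near[of v] v by (intro mult_left_mono tent_nonneg) auto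
    moreover have "0 \<le> \<tau> * (2 * s)" using \<tau> s by simp
    ultimately show ?thesis by linarith
  next
    case False
    then obtain i where i: "1 - \<tau> < \<bar>real N * x $ i - of_int (v i)\<bar>" by (auto simp: not_le)
    have "?t v \<le> \<tau>" using tent_le[of "real N *\<^sub>R x - int_vec v" i] i \<tau> by simp
    moreover have "norm (c v - y) \<le> 2 * s"
    proof (rule far)
      fix j show "\<bar>real N * x $ j - of_int (v j)\<bar> < 1"
        using v tent_eq_0[of "real N *\<^sub>R x - int_vec v" j] by (simp add: not_le[symmetric]) blast
    qed (use v in auto)
    ultimately have "?t v * norm (c v - y) \<le> \<tau> * (2 * s)"
      using \<tau> by (intro mult_mono) auto
    moreover have "0 \<le> ?t v * (\<kappa> * s)" using tent_nonneg[of "real N *\<^sub>R x - int_vec v"] \<kappa> s by (simp only: mult_nonneg_nonneg)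
    ultimately show ?thesis by linarith
  qed
  have "grid_interp N c x - y = (\<Sum>v\<in>grid N. ?t v *\<^sub>R (c v - y))"
    using sum1 by (simp add: grid_interp_def scaleR_diff_right sum_subtractf flip: scaleR_sum_left)
  then have "norm (grid_interp N c x - y) \<le> (\<Sum>v\<in>grid N. ?t v * norm (c v - y))"
    by (simp add: sum_norm_le tent_nonneg)
  also have "\<dots> = (\<Sum>v\<in>?S. ?t v * norm (c v - y))" by (rule S[symmetric]) simp
  also have "\<dots> \<le> (\<Sum>v\<in>?S. ?t v * (\<kappa> * s) + \<tau> * (2 * s))" by (rule sum_mono) (rule le)
  also have "\<dots> = (\<Sum>v\<in>?S. ?t v) * (\<kappa> * s) + card ?S * (\<tau> * (2 * s))"
    by (simp add: sum.distrib sum_distrib_right)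
  also have "(\<Sum>v\<in>?S. ?t v) = 1" using sum1 by (subst S) auto
  also have "card ?S * (\<tau> * (2 * s)) \<le> 2 ^ CARD('d) * (\<tau> * (2 * s))"
  proof (rule mult_right_mono)
    show "real (card ?S) \<le> 2 ^ CARD('d)"
      using card_tent_support[of N "real N *\<^sub>R x"] by (metis (no_types, lifting) of_nat_le_iff of_nat_numeral of_nat_power)
  qed (use \<tau> s in simp)
  finally show ?thesis by (simp add: algebra_simps)
qed

text \<open>The vertex value \<open>c v\<close> is a near centre of the values of \<open>f\<close>
  on the ball \<open>S v\<close> of radius \<open>L / 2\<close>; \<open>X1\<close> contains these
  balls for all vertices close to \<open>X0\<close>. In \<open>grid_interp_approx\<close> the choice
  \<open>\<tau> = 1 / (N + 1)\<close> is made because \<open>(1 - \<tau>) / N = 1 / (N + 1)\<close>: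
  a point within that distance of the vertex in every coordinate is closer to it than
  \<open>L / 2\<close>, hence in \<open>S v\<close>. For the other vertices of nonzero weight the
  distance is still below \<open>L\<close>, and comparison with the value of \<open>f\<close> at the
  vertex itself gives \<open>2 * s\<close>.\<close>

lemma ex_grid_values:
  fixes f :: "real ^ 'd::finite \<Rightarrow> 'b::euclidean_space"
  assumes q: "linear q" "\<And>x. x \<in> X1 \<Longrightarrow> q (f x) = f x"
    and X1: "\<And>x v. x \<in> X0 \<Longrightarrow> v \<in> unit_cube \<Longrightarrow> norm (x - v) < L \<Longrightarrow>
        {y \<in> unit_cube. norm (y - v) < L / 2} \<subseteq> X1"
    and X0: "X0 \<subseteq> unit_cube"
    and f: "\<And>x y. x \<in> X1 \<Longrightarrow> y \<in> X1 \<Longrightarrow> norm (x - y) < L \<Longrightarrow> norm (f x - f y) \<le> s"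
    and N: "0 < N" "sqrt CARD('d) / N < L" "sqrt CARD('d) / (real N + 1) < L / 2" and "0 \<le> s"
  shows "\<exists>c. (\<forall>v. q (c v) = c v) \<and>
    (\<forall>x\<in>X0. norm (grid_interp N c x - f x) \<le> (31 / 32 + 2 ^ CARD('d) * (2 * (1 / (real N + 1)))) * s)"
proof -
  have L: "0 < L" using N by (smt (verit) divide_nonneg_nonneg of_nat_0_le_iff real_sqrt_ge_zero)
  define pt where "pt v = (1 / real N) *\<^sub>R int_vec v" for v :: "'d \<Rightarrow> int"
  define S where "S v = {y \<in> unit_cube. norm (y - pt v) < L / 2}" for v
  have pt: "pt v \<in> unit_cube" if "v \<in> grid N" for v
  proof -
    have "0 \<le> real_of_int (v i)" "real_of_int (v i) \<le> real N" for i
      using that by (auto simp: grid_def) (metis of_int_le_iff of_int_of_nat_eq)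
    then show ?thesis using N(1) by (auto simp: pt_def mem_unit_cube_iff)
  qed
  have "\<exists>c. q c = c \<and> (v \<in> grid N \<longrightarrow> S v \<subseteq> X1 \<longrightarrow> (\<forall>x\<in>S v. norm (f x - c) \<le> 31 / 32 * s))" for v
  proof (cases "v \<in> grid N \<and> S v \<subseteq> X1")
    case True
    have "norm (x - y) < L" if "x \<in> S v" "y \<in> S v" for x y
      using that norm_triangle_ineq4[of "x - pt v" "y - pt v"] by (auto simp: S_def)
    then have "norm (a - b) \<le> s" if "a \<in> f ` S v" "b \<in> f ` S v" for a b
      using f that True by blast
    moreover have "pt v \<in> S v" using pt[of v] True L by (auto simp: S_def)
    ultimately obtain c where c: "c \<in> convex hull (f ` S v)" "\<And>a. a \<in> f ` S v \<Longrightarrow> norm (a - c) \<le> 31 / 32 * s"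
      using near_center[of "f ` S v" s] by (metis empty_iff image_is_empty)
    have "convex hull (f ` S v) \<subseteq> {y. q y = y}"
    proof (rule hull_minimal)
      show "f ` S v \<subseteq> {y. q y = y}" using q(2) True by auto
      show "convex {y. q y = y}"
        by (auto simp: convex_def linear_add[OF q(1)] linear_cmul[OF q(1)])
    qed
    then have "q c = c" using c(1) by blast
    then show ?thesis using c(2) by blast
  next
    case False
    \<comment> \<open>Default for vertices outside the grid or without influence on
      \<open>X0\<close>; it only has to be fixed by \<open>q\<close>.\<close>
    then show ?thesis using linear_0[OF q(1)] by (intro exI[of _ 0]) auto
  qed
  then obtain c where c: "\<And>v. q (c v) = c v"
    "\<And>v x. v \<in> grid N \<Longrightarrow> S v \<subseteq> X1 \<Longrightarrow> x \<in> S v \<Longrightarrow> norm (f x - c v) \<le> 31 / 32 * s" by metis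
  have "norm (grid_interp N c x - f x) \<le> (31 / 32 + 2 ^ CARD('d) * (2 * (1 / (real N + 1)))) * s"
    if x: "x \<in> X0" for x
  proof (rule grid_interp_approx)
    show xc: "x \<in> unit_cube" using x X0 by blast
    have xX1: "x \<in> X1" using X1[OF x xc] L xc by auto
    have coord: "\<bar>(x - pt v) $ i\<bar> = \<bar>real N * x $ i - of_int (v i)\<bar> / real N" for v i
    proof -
      have "(x - pt v) $ i = (real N * x $ i - of_int (v i)) / real N"
        using N(1) by (simp add: pt_def field_simps)
      then show ?thesis by (simp add: abs_divide)
    qed
    have farS: "S v \<subseteq> X1" "norm (x - pt v) < L"
      if v: "v \<in> grid N" "\<And>i. \<bar>real N * x $ i - of_int (v i)\<bar> < 1" for v
    proof -
      have "norm (x - pt v) \<le> sqrt CARD('d) * (1 / N)"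
      proof (rule norm_le_sqrt_card)
        show "\<bar>(x - pt v) $ i\<bar> \<le> 1 / N" for i
          unfolding coord using v(2)[of i] by (intro divide_right_mono) auto
      qed simp
      then show "norm (x - pt v) < L" using N(2) by simp
      then show "S v \<subseteq> X1" using X1[OF x pt[OF v(1)]] by (simp add: S_def)
    qed
    show "norm (c v - f x) \<le> 31 / 32 * s"
      if v: "v \<in> grid N" "\<And>i. \<bar>real N * x $ i - of_int (v i)\<bar> \<le> 1 - 1 / (real N + 1)" for v
    proof -
      have "\<bar>real N * x $ i - of_int (v i)\<bar> < 1" for i using v(2)[of i] by (smt (verit) divide_pos_pos of_nat_0_le_iff)
      then have S1: "S v \<subseteq> X1" using farS v(1) by blast
      have "\<bar>(x - pt v) $ i\<bar> \<le> 1 / (real N + 1)" for i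
      proof -
        have "\<bar>(x - pt v) $ i\<bar> \<le> (1 - 1 / (real N + 1)) / real N"
          unfolding coord using v(2) by (intro divide_right_mono) auto
        also have "\<dots> = 1 / (real N + 1)"
        proof -
          have "1 - 1 / (real N + 1) = real N / (real N + 1)" by (simp add: field_simps)
          then show ?thesis using N(1) by simp
        qed
        finally show ?thesis .
      qed
      then have "norm (x - pt v) \<le> sqrt CARD('d) * (1 / (real N + 1))"
        by (rule norm_le_sqrt_card) simp
      then have "norm (x - pt v) < L / 2" using N(3) by (simp only: times_divide_eq_right mult_1_right)
      then have "x \<in> S v" using xc by (simp add: S_def)
      then show ?thesis using c(2)[OF v(1) S1] by (simp add: norm_minus_commute)
    qed
    show "norm (c v - f x) \<le> 2 * s"
      if v: "v \<in> grid N" "\<And>i. \<bar>real N * x $ i - of_int (v i)\<bar> < 1" for v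
    proof -
      have "pt v \<in> S v" using pt[OF v(1)] L by (auto simp: S_def)
      then have "norm (f (pt v) - c v) \<le> 31 / 32 * s" "pt v \<in> X1"
        using c(2) v(1) farS(1)[OF v] by blast+
      moreover have "norm (f x - f (pt v)) \<le> s"
        using f[OF xX1 \<open>pt v \<in> X1\<close>] farS(2)[OF v] by simp
      ultimately show ?thesis
        using norm_triangle_ineq[of "f x - f (pt v)" "f (pt v) - c v"] \<open>0 \<le> s\<close>
        by (simp add: norm_minus_commute)
    qed
  qed (use \<open>0 \<le> s\<close> in auto)
  then show ?thesis using c(1) by blast
qed

text \<open>One translation serves all simplices, as there are finitely many. On each of them the
  level set is empty or lies in a translate of an \<open>n\<close>-dimensional kernel, and it lies
  inside a cube of side \<open>1 / N\<close>, whence the diameter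
  \<open>sqrt CARD('d) / N\<close>.\<close>

lemma generic_level_set_covers:
  fixes c :: "('d::finite \<Rightarrow> int) \<Rightarrow> 'b::euclidean_space"
  assumes q: "linear q" "\<And>y. q (q y) = q y" "\<And>y. norm (q y) \<le> norm y" "\<And>v. q (c v) = c v"
    and \<eta>: "\<eta> > 0" and N: "0 < N" and n: "n + dim (range q) = CARD('d)"
  shows "\<exists>y. q y = y \<and> norm y < \<eta> \<and> (\<forall>z\<in>grid N. \<forall>xs\<in>permutations_of_set UNIV.
    has_fine_covers (real n) ((sqrt n * (sqrt CARD('d) / N)) ^ n)
      {x. real N *\<^sub>R x \<in> kuhn_cell z xs \<and> grid_interp N c x = y})"
proof -
  define I where "I = (grid N :: ('d \<Rightarrow> int) set) \<times> permutations_of_set (UNIV :: 'd set)"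
  have fin: "finite I" by (simp add: I_def finite_grid)
  have "\<exists>A b. linear A \<and> (\<forall>x. q (A x) = A x) \<and> q b = b \<and>
    (\<forall>x. real N *\<^sub>R x \<in> kuhn_cell (fst i) (snd i) \<longrightarrow> grid_interp N c x = A x + b)" if "i \<in> I" for i
    using that by (intro grid_interp_affine q) (auto simp: I_def permutations_of_set_def)
  then obtain A b where A: "\<And>i. i \<in> I \<Longrightarrow> linear (A i)" "\<And>i x. i \<in> I \<Longrightarrow> q (A i x) = A i x"
      "\<And>i. i \<in> I \<Longrightarrow> q (b i) = b i"
    and eq: "\<And>i x. i \<in> I \<Longrightarrow> real N *\<^sub>R x \<in> kuhn_cell (fst i) (snd i) \<Longrightarrow> grid_interp N c x = A i x + b i"
    by metis
  obtain y where y3: "q y = y \<and> norm y < \<eta> \<and>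
      (\<forall>i\<in>I. (\<forall>x. A i x + b i \<noteq> y) \<or> dim {x. A i x = 0} + dim (range q) = DIM(real ^ 'd))"
    using generic_shift[OF q(1-3) fin A \<eta>] by (rule exE)
  then have y: "q y = y" "norm y < \<eta>"
    "\<And>i. i \<in> I \<Longrightarrow> (\<forall>x. A i x + b i \<noteq> y) \<or> dim {x. A i x = 0} + dim (range q) = DIM(real ^ 'd)"
    by blast+
  have "has_fine_covers (real n) ((sqrt n * (sqrt CARD('d) / N)) ^ n)
      {x. real N *\<^sub>R x \<in> kuhn_cell z xs \<and> grid_interp N c x = y}" (is "has_fine_covers _ _ ?Z")
    if i: "(z, xs) \<in> I" for z xs
  proof (cases "\<forall>x. A (z, xs) x + b (z, xs) \<noteq> y")
    case True
    then have "?Z = {}" using eq[OF i] by auto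
    show ?thesis unfolding \<open>?Z = {}\<close>
      using has_fine_covers_mono[OF has_fine_covers_empty order_refl, of "(sqrt n * (sqrt CARD('d) / N)) ^ n" "real n"]
      by simp
  next
    case False
    show ?thesis
    proof (rule has_fine_covers_affine)
      show "subspace {x. A (z, xs) x = 0}" by (rule linear_subspace_kernel[OF A(1)[OF i]])
      show "dim {x. A (z, xs) x = 0} = n" using y(3)[OF i] False n by auto
      show "x - x' \<in> {x. A (z, xs) x = 0}" if "x \<in> ?Z" "x' \<in> ?Z" for x x'
      proof -
        have "A (z, xs) x + b (z, xs) = y" "A (z, xs) x' + b (z, xs) = y"
          using that eq[OF i] by auto
        then have "A (z, xs) x = A (z, xs) x'" by (metis add_right_cancel)
        then show ?thesis by (simp add: linear_diff[OF A(1)[OF i]])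
      qed
      show "norm (x - x') \<le> sqrt CARD('d) / N" if "x \<in> ?Z" "x' \<in> ?Z" for x x'
      proof -
        have "\<bar>(x - x') $ j\<bar> \<le> 1 / N" for j
        proof -
          have "of_int (z j) \<le> N * x $ j" "N * x $ j \<le> of_int (z j) + 1"
            "of_int (z j) \<le> N * x' $ j" "N * x' $ j \<le> of_int (z j) + 1"
            using that by (auto simp: kuhn_cell_def)
          then have "\<bar>N * x $ j - N * x' $ j\<bar> \<le> 1" by linarith
          then have "N * \<bar>x $ j - x' $ j\<bar> \<le> 1" by (simp add: abs_mult flip: right_diff_distrib)
          then show ?thesis using N by (simp add: field_simps)
        qed
        then have "norm (x - x') \<le> sqrt CARD('d) * (1 / N)" by (rule norm_le_sqrt_card) simp
        then show ?thesis by simp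
      qed
    qed simp
  qed
  then show ?thesis using y(1,2) by (auto simp: I_def)
qed

section \<open>Counting the cubes of the grid\<close>

definition cells :: "nat \<Rightarrow> ('d::finite \<Rightarrow> int) set" where
  "cells N = {z. \<forall>i. 0 \<le> z i \<and> z i < int N}"

lemma cells_eq_PiE: "(cells N :: ('d::finite \<Rightarrow> int) set) = PiE UNIV (\<lambda>_. {0..<int N})"
  by (auto simp: cells_def PiE_def Pi_def)

lemma finite_cells: "finite (cells N :: ('d::finite \<Rightarrow> int) set)"
  unfolding cells_eq_PiE by (intro finite_PiE) auto

lemma card_cells: "card (cells N :: ('d::finite \<Rightarrow> int) set) = N ^ CARD('d)"
  unfolding cells_eq_PiE by (simp add: card_PiE)

definition cell_box :: "nat \<Rightarrow> ('d::finite \<Rightarrow> int) \<Rightarrow> (real ^ 'd) set" where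
  "cell_box N z = {x. \<forall>i. of_int (z i) \<le> N * x $ i \<and> N * x $ i \<le> of_int (z i) + 1}"

text \<open>Only cubes that meet \<open>Z\<close> are counted, and each is a union of
  \<open>fact CARD('d)\<close> simplices, one for every order of the coordinates.\<close>

lemma level_set_covers:
  fixes Z :: "(real ^ 'd::finite) set"
  assumes N: "0 < N" and Z: "Z \<subseteq> unit_cube" "\<And>x. x \<in> Z \<Longrightarrow> u x = y"
    and cov: "\<And>z xs. z \<in> grid N \<Longrightarrow> xs \<in> permutations_of_set UNIV \<Longrightarrow>
      has_fine_covers s B {x. real N *\<^sub>R x \<in> kuhn_cell z xs \<and> u x = y}"
  shows "has_fine_covers s (real (card {z\<in>cells N. Z \<inter> cell_box N z \<noteq> {}}) * (fact CARD('d) * B)) Z"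
proof -
  let ?K = "{z\<in>cells N. Z \<inter> cell_box N z \<noteq> {}} :: ('d \<Rightarrow> int) set"
  let ?P = "permutations_of_set (UNIV :: 'd set)"
  let ?A = "\<lambda>z xs. {x. real N *\<^sub>R x \<in> kuhn_cell z xs \<and> u x = y}"
  have K: "finite ?K" "?K \<subseteq> grid N"
  proof -
    show "finite ?K" by (rule finite_subset[OF _ finite_cells[of N]]) blast
    show "?K \<subseteq> grid N" by (auto simp: cells_def grid_def less_imp_le)
  qed
  have "has_fine_covers s (real (card ?P) * B) (\<Union>xs\<in>?P. ?A z xs)" if "z \<in> ?K" for z
    using that K(2) by (intro has_fine_covers_UN cov) auto
  then have "has_fine_covers s (real (card ?K) * (real (card ?P) * B)) (\<Union>z\<in>?K. \<Union>xs\<in>?P. ?A z xs)"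
    by (rule has_fine_covers_UN[OF K(1)])
  moreover have "Z \<subseteq> (\<Union>z\<in>?K. \<Union>xs\<in>?P. ?A z xs)"
  proof
    fix x assume x: "x \<in> Z"
    then have "0 \<le> x $ i \<and> x $ i \<le> 1" for i using Z(1) mem_unit_cube_iff by blast
    then have "0 \<le> (real N *\<^sub>R x) $ i \<and> (real N *\<^sub>R x) $ i \<le> real N" for i
      using N by (auto intro: mult_left_le)
    from in_kuhn_cell[OF N this] obtain z xs where z: "\<And>i. 0 \<le> z i \<and> z i < int N"
      "xs \<in> ?P" "real N *\<^sub>R x \<in> kuhn_cell z xs" by blast
    have "x \<in> cell_box N z" using z(3) by (auto simp: kuhn_cell_def cell_box_def)
    then have "z \<in> ?K" using z(1) x by (auto simp: cells_def)
    then show "x \<in> (\<Union>z\<in>?K. \<Union>xs\<in>?P. ?A z xs)" using z(2,3) Z(2)[OF x] by blast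
  qed
  ultimately show ?thesis
    by (elim has_fine_covers_mono) auto
qed

lemma card_int_interval:
  "finite {k::int. a \<le> of_int k \<and> of_int k \<le> a + 3}" "card {k::int. a \<le> of_int k \<and> of_int k \<le> a + 3} \<le> 4"
  for a :: real
proof -
  have eq: "{k::int. a \<le> of_int k \<and> of_int k \<le> a + 3} = {\<lceil>a\<rceil>..\<lfloor>a + 3\<rfloor>}"
    by (rule set_eqI) (simp only: mem_Collect_eq atLeastAtMost_iff ceiling_le_iff le_floor_iff)
  have "\<lfloor>a + 3\<rfloor> - \<lceil>a\<rceil> + 1 \<le> 4" by linarith
  then show "card {k::int. a \<le> of_int k \<and> of_int k \<le> a + 3} \<le> 4"
    unfolding eq card_atLeastAtMost_int by (simp only: nat_le_iff of_nat_numeral)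
  show "finite {k::int. a \<le> of_int k \<and> of_int k \<le> a + 3}" unfolding eq by simp
qed

text \<open>After scaling by \<open>N\<close> the set extends over at most \<open>2\<close> in each
  coordinate, so the corners of the cubes that meet it have coordinates in an interval of length
  \<open>3\<close>, which contains at most four integers.\<close>

lemma card_cells_meeting:
  fixes A :: "(real ^ 'd::finite) set"
  assumes N: "0 < N" and A: "\<And>x y. x \<in> A \<Longrightarrow> y \<in> A \<Longrightarrow> norm (x - y) \<le> 2 / N"
  shows "card {z\<in>cells N. A \<inter> cell_box N z \<noteq> {}} \<le> 4 ^ CARD('d)"
proof (cases "A = {}")
  case False
  then obtain x0 where x0: "x0 \<in> A" by blast
  define \<beta> where "\<beta> i = (INF x\<in>A. N * x $ i)" for i
  have co: "N * x $ i \<le> N * y $ i + 2" if "x \<in> A" "y \<in> A" for x y i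
  proof -
    have "x $ i - y $ i \<le> 2 / N"
      using A[OF that] component_le_norm_cart[of "x - y" i] by (simp add: abs_le_iff)
    then have "N * (x $ i - y $ i) \<le> 2" using N by (simp add: field_simps)
    then show ?thesis by (simp add: algebra_simps)
  qed
  have \<beta>: "\<beta> i \<le> N * x $ i" "N * x $ i \<le> \<beta> i + 2" if "x \<in> A" for x i
  proof -
    have "bdd_below ((\<lambda>x. N * x $ i) ` A)"
    proof (rule bdd_belowI2)
      fix y assume "y \<in> A" then show "N * x0 $ i - 2 \<le> N * y $ i" using co[OF x0, of y i] by simp
    qed
    then show "\<beta> i \<le> N * x $ i" unfolding \<beta>_def using that by (rule cINF_lower)
    have "N * x $ i - 2 \<le> \<beta> i" unfolding \<beta>_def
    proof (rule cINF_greatest[OF False])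
      fix y assume "y \<in> A" then show "N * x $ i - 2 \<le> N * y $ i" using co[OF that, of y i] by simp
    qed
    then show "N * x $ i \<le> \<beta> i + 2" by simp
  qed
  let ?E = "\<lambda>i. {k::int. \<beta> i - 1 \<le> of_int k \<and> of_int k \<le> \<beta> i - 1 + 3}"
  have "{z\<in>cells N. A \<inter> cell_box N z \<noteq> {}} \<subseteq> PiE UNIV ?E"
  proof
    fix z assume "z \<in> {z\<in>cells N. A \<inter> cell_box N z \<noteq> {}}"
    then obtain x where x: "x \<in> A" "x \<in> cell_box N z" by auto
    have "z i \<in> ?E i" for i
      using \<beta>[OF x(1), of i] x(2) unfolding cell_box_def by (simp, smt (verit))
    then show "z \<in> PiE UNIV ?E" by auto
  qed
  moreover have "finite (PiE UNIV ?E)" by (intro finite_PiE card_int_interval) simp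
  ultimately have "card {z\<in>cells N. A \<inter> cell_box N z \<noteq> {}} \<le> card (PiE UNIV ?E)"
    by (rule card_mono[rotated])
  also have "\<dots> = (\<Prod>i\<in>UNIV. card (?E i))" by (simp add: card_PiE)
  also have "\<dots> \<le> (\<Prod>i\<in>(UNIV::'d set). 4)" by (rule prod_mono) (simp only: card_int_interval le0 simp_thms)
  finally show ?thesis by simp
qed simp

lemma card_cells_meeting_cover:
  fixes G :: "(real ^ 'd::finite) set"
  assumes N: "0 < N" and fin: "finite \<C>" and G: "G \<subseteq> \<Union>\<C>"
    and \<C>: "\<And>A. A \<in> \<C> \<Longrightarrow> bounded A \<and> diameter A \<le> 2 / N"
  shows "card {z\<in>cells N. G \<inter> cell_box N z \<noteq> {}} \<le> card \<C> * 4 ^ CARD('d)"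
proof -
  have "{z\<in>cells N. G \<inter> cell_box N z \<noteq> {}} \<subseteq> (\<Union>A\<in>\<C>. {z\<in>cells N. A \<inter> cell_box N z \<noteq> {}})"
    using G by blast
  then have "card {z\<in>cells N. G \<inter> cell_box N z \<noteq> {}} \<le>
      card (\<Union>A\<in>\<C>. {z\<in>cells N. A \<inter> cell_box N z \<noteq> {}})"
    using fin finite_cells[of N] by (intro card_mono) auto
  also have "\<dots> \<le> (\<Sum>A\<in>\<C>. card {z\<in>cells N. A \<inter> cell_box N z \<noteq> {}})"
    by (rule card_UN_le[OF fin])
  also have "\<dots> \<le> (\<Sum>A\<in>\<C>. 4 ^ CARD('d))"
  proof (rule sum_mono)
    fix A assume "A \<in> \<C>"
    then have "norm (x - y) \<le> 2 / N" if "x \<in> A" "y \<in> A" for x y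
      using \<C> diameter_bounded_bound[of A x y] that by (force simp: dist_norm)
    then show "card {z\<in>cells N. A \<inter> cell_box N z \<noteq> {}} \<le> 4 ^ CARD('d)"
      using N by (intro card_cells_meeting) auto
  qed
  finally show ?thesis by simp
qed

subsection \<open>Charts, moduli of continuity and entropy\<close>

lemma C1_on_imp_continuous_on: "C1_on f S \<Longrightarrow> continuous_on S f"
  unfolding C1_on_def
  by (metis continuous_at_imp_continuous_on has_derivative_continuous)

text \<open>Turns the extended-real dilations into a two-sided Lipschitz estimate with real
  constants.\<close>

lemma global_C1_manifoldE:
  assumes "global_C1_manifold W p P r \<phi>"
  obtains \<mu> \<nu> where "0 < \<mu>" "\<mu> \<le> \<nu>" "chart_gamma W r \<phi> = \<mu> / \<nu>" "W \<noteq> {}"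
    "\<And>x y. x \<in> tube W r \<Longrightarrow> y \<in> tube W r \<Longrightarrow> \<mu> * norm (x - y) \<le> norm (\<phi> x - \<phi> y)"
    "\<And>x y. x \<in> tube W r \<Longrightarrow> y \<in> tube W r \<Longrightarrow> norm (\<phi> x - \<phi> y) \<le> \<nu> * norm (x - y)"
proof -
  let ?S = "tube W r"
  let ?D = "{(x, y). x \<in> ?S \<and> y \<in> ?S \<and> x \<noteq> y}"
  let ?Q = "\<lambda>(x, y). ereal (norm (\<phi> x - \<phi> y) / norm (x - y))"
  have m: "0 < lower_dilation \<phi> ?S" "lower_dilation \<phi> ?S \<le> upper_dilation \<phi> ?S" "upper_dilation \<phi> ?S < \<infinity>"
    using assms by (auto simp: global_C1_manifold_def)
  define \<mu> where "\<mu> = real_of_ereal (lower_dilation \<phi> ?S)"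
  define \<nu> where "\<nu> = real_of_ereal (upper_dilation \<phi> ?S)"
  have e1: "lower_dilation \<phi> ?S = ereal \<mu>" and e2: "upper_dilation \<phi> ?S = ereal \<nu>"
    using m by (auto simp: \<mu>_def \<nu>_def intro!: ereal_real'[symmetric])
  \<comment> \<open>For empty \<open>W\<close> the lower dilation would be an infimum over the empty
    set, that is \<open>\<infinity>\<close>, against the finite upper one.\<close>
  have W: "W \<noteq> {}"
  proof
    assume "W = {}"
    then have "?D = {}" by (auto simp: tube_def)
    then have "lower_dilation \<phi> ?S = \<infinity>"
      unfolding lower_dilation_def by (simp only: image_empty Inf_empty top_ereal_def)
    then show False using m by auto
  qed
  have lo: "\<mu> * norm (x - y) \<le> norm (\<phi> x - \<phi> y)" if "x \<in> ?S" "y \<in> ?S" for x y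
  proof (cases "x = y")
    case False
    have "lower_dilation \<phi> ?S \<le> ?Q (x, y)"
      unfolding lower_dilation_def using that False by (intro INF_lower) auto
    then have "\<mu> \<le> norm (\<phi> x - \<phi> y) / norm (x - y)" by (simp add: e1)
    then show ?thesis using False by (simp add: pos_le_divide_eq)
  qed simp
  have up: "norm (\<phi> x - \<phi> y) \<le> \<nu> * norm (x - y)" if "x \<in> ?S" "y \<in> ?S" for x y
  proof (cases "x = y")
    case False
    have "?Q (x, y) \<le> upper_dilation \<phi> ?S"
      unfolding upper_dilation_def using that False by (intro SUP_upper) auto
    then have "norm (\<phi> x - \<phi> y) / norm (x - y) \<le> \<nu>" by (simp add: e2)
    then show ?thesis using False by (simp add: pos_divide_le_eq)
  qed simp
  show ?thesis
    using that[of \<mu> \<nu>] m W lo up by (simp add: e1 e2 chart_gamma_def \<mu>_def[symmetric] \<nu>_def[symmetric])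
qed

section \<open>From the chart to a perturbation of \<open>g\<close>\<close>

lemma infdist_less_imp_tube:
  assumes "W \<noteq> {}" "infdist x W < \<rho>"
  shows "x \<in> tube W \<rho>"
proof -
  have "(INF a\<in>W. dist x a) < \<rho>" using assms by (simp add: infdist_def)
  then obtain a where "a \<in> W" "dist x a < \<rho>"
    using assms(1) by (subst (asm) cINF_less_iff) (auto intro!: bdd_belowI[of _ 0])
  then show ?thesis by (auto simp: tube_def dist_commute)
qed

text \<open>Used with \<open>Q = - P\<close>, where it keeps the normal coordinates, those that
  vanish on the image of \<open>W\<close> under the chart. The values stay in
  \<open>real ^ 'm\<close> because the codimension is a number and not a type.\<close>

definition coord_proj :: "'m::finite set \<Rightarrow> real ^ 'm \<Rightarrow> real ^ 'm" where
  "coord_proj Q y = (\<chi> i. if i \<in> Q then y $ i else 0)"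

lemma linear_coord_proj: "linear (coord_proj Q)"
  by (rule linearI) (auto simp: coord_proj_def vec_eq_iff)

lemma coord_proj_idem [simp]: "coord_proj Q (coord_proj Q y) = coord_proj Q y"
  by (simp add: coord_proj_def vec_eq_iff)

lemma norm_coord_proj_le: "norm (coord_proj Q y) \<le> norm y"
  by (rule norm_le_componentwise_cart) (simp add: coord_proj_def)

lemma dim_range_coord_proj: "dim (range (coord_proj Q)) = card Q"
proof -
  have "range (coord_proj Q) = {x. \<forall>i. i \<notin> Q \<longrightarrow> x $ i = 0}"
  proof (intro equalityI subsetI)
    fix x :: "real ^ 'a" assume "x \<in> {x. \<forall>i. i \<notin> Q \<longrightarrow> x $ i = 0}"
    then have "coord_proj Q x = x" by (auto simp: coord_proj_def vec_eq_iff)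
    then show "x \<in> range (coord_proj Q)" by (metis rangeI)
  qed (auto simp: coord_proj_def)
  then show ?thesis using dim_substandard_cart[of Q, where 'a = real] by (simp add: dim_vec_eq)
qed

lemma coord_proj_eq_0: "y \<in> coord_subspace P \<Longrightarrow> coord_proj (- P) y = 0"
  by (simp add: coord_subspace_def coord_proj_def vec_eq_iff)

text \<open>Near \<open>W\<close> the normal coordinates of \<open>\<phi> (g x)\<close> are replaced
  by \<open>u x\<close> and the tangential ones are kept. In the chart this moves the point by less
  than \<open>\<mu> * \<epsilon>\<close>, hence by less than \<open>\<epsilon>\<close> after the
  inverse chart, because of the lower dilation. If the new point lies in \<open>W\<close>, its
  normal coordinates \<open>u x\<close> vanish.\<close>

lemma ex_perturbation:
  fixes g :: "real ^ 'd::finite \<Rightarrow> real ^ 'm::finite"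
  assumes W: "global_C1_manifold W p P r \<phi>" and ne: "W \<noteq> {}"
    and lo: "0 < \<mu>" "\<And>x y. x \<in> tube W r \<Longrightarrow> y \<in> tube W r \<Longrightarrow> \<mu> * norm (x - y) \<le> norm (\<phi> x - \<phi> y)"
    and g: "continuous_on unit_cube g" and u: "continuous_on unit_cube u" "\<And>x. coord_proj (- P) (u x) = u x"
    and close: "\<And>x. x \<in> unit_cube \<Longrightarrow> infdist (g x) W \<le> r / 2 \<Longrightarrow>
        norm (u x - coord_proj (- P) (\<phi> (g x))) < \<mu> * \<epsilon>"
    and \<epsilon>: "0 < \<epsilon>" "\<epsilon> \<le> r / 4"
    and room: "\<And>x. x \<in> unit_cube \<Longrightarrow> infdist (g x) W \<le> r / 2 \<Longrightarrow> ball (\<phi> (g x)) (\<mu> * \<epsilon>) \<subseteq> \<phi> ` tube W r"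
  shows "\<exists>h. continuous_on unit_cube h \<and> (\<forall>x\<in>unit_cube. norm (h x - g x) < \<epsilon> \<and> (h x \<in> W \<longrightarrow> u x = 0))"
proof -
  let ?S = "tube W r" and ?q = "coord_proj (- P)"
  have r: "0 < r" and inj: "inj_on \<phi> ?S" and \<phi>W: "\<phi> ` W \<subseteq> coord_subspace P"
    and C1: "C1_on \<phi> ?S" "C1_on (the_inv_into ?S \<phi>) (\<phi> ` ?S)"
    using W by (auto simp: global_C1_manifold_def C1_diffeomorphism_on_def)
  note cont = C1[THEN C1_on_imp_continuous_on]
  define \<psi> where "\<psi> = the_inv_into ?S \<phi>"
  have \<psi>: "\<psi> (\<phi> y) = y" if "y \<in> ?S" for y
    using that inj by (simp add: \<psi>_def the_inv_into_f_f)
  have \<psi>': "\<phi> (\<psi> z) = z" "\<psi> z \<in> ?S" if "z \<in> \<phi> ` ?S" for z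
    using that \<psi> by auto
  define D where "D x = infdist (g x) W" for x
  have Dc: "continuous_on unit_cube D"
    unfolding D_def by (intro continuous_on_infdist g)
  \<comment> \<open>Cut-off that is \<open>1\<close> where \<open>D x \<le> r / 4\<close> and
    \<open>0\<close> where \<open>D x \<ge> r / 2\<close>.\<close>
  define \<theta> where "\<theta> x = max 0 (min 1 (2 - 4 * D x / r))" for x
  have \<theta>c: "continuous_on unit_cube \<theta>"
    unfolding \<theta>_def using r by (intro continuous_intros Dc) auto
  have \<theta>01: "0 \<le> \<theta> x" "\<theta> x \<le> 1" for x by (auto simp: \<theta>_def)
  define F where "F x = \<phi> (g x) + \<theta> x *\<^sub>R (u x - ?q (\<phi> (g x)))" for x
  define X where "X = {x \<in> unit_cube. D x \<le> r / 2}"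
  have gS: "g x \<in> ?S" if "x \<in> X" for x
    using that infdist_less_imp_tube[OF ne, of "g x" r] r by (auto simp: X_def D_def)
  have FS: "norm (F x - \<phi> (g x)) < \<mu> * \<epsilon>" "F x \<in> \<phi> ` ?S" if x: "x \<in> X" for x
  proof -
    have c: "norm (u x - ?q (\<phi> (g x))) < \<mu> * \<epsilon>" using close x by (auto simp: X_def D_def)
    have "norm (F x - \<phi> (g x)) = \<theta> x * norm (u x - ?q (\<phi> (g x)))" using \<theta>01 by (simp add: F_def)
    also have "\<dots> \<le> norm (u x - ?q (\<phi> (g x)))" using \<theta>01 by (intro mult_left_le_one_le) auto
    finally show "norm (F x - \<phi> (g x)) < \<mu> * \<epsilon>" using c by simp
    then have "F x \<in> ball (\<phi> (g x)) (\<mu> * \<epsilon>)" by (simp add: dist_norm norm_minus_commute)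
    moreover have "ball (\<phi> (g x)) (\<mu> * \<epsilon>) \<subseteq> \<phi> ` ?S" using x by (intro room) (simp_all add: X_def D_def)
    ultimately show "F x \<in> \<phi> ` ?S" by blast
  qed
  \<comment> \<open>At \<open>D x = r / 2\<close> the cut-off vanishes, so both branches equal
    \<open>g x\<close> and the pieces fit together continuously.\<close>
  define h where "h x = (if D x \<le> r / 2 then \<psi> (F x) else g x)" for x
  have "continuous_on X F"
  proof -
    have "continuous_on X g" by (rule continuous_on_subset[OF g]) (auto simp: X_def)
    then have "continuous_on X (\<lambda>x. \<phi> (g x))"
      by (rule continuous_on_compose2[OF cont(1)]) (use gS in auto)
    moreover from this have "continuous_on X (\<lambda>x. ?q (\<phi> (g x)))"
      by (rule linear_continuous_on_compose[OF _ linear_coord_proj])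
    moreover have "continuous_on X \<theta>" "continuous_on X u"
      by (rule continuous_on_subset[OF \<theta>c], auto simp: X_def) (rule continuous_on_subset[OF u(1)], auto simp: X_def)
    ultimately show ?thesis unfolding F_def by (intro continuous_intros)
  qed
  then have cF: "continuous_on X (\<lambda>x. \<psi> (F x))"
    unfolding \<psi>_def by (rule continuous_on_compose2[OF cont(2)]) (use FS in auto)
  have "continuous_on unit_cube h"
    unfolding h_def
  proof (rule continuous_on_cases_le)
    show "continuous_on {x \<in> unit_cube. D x \<le> r / 2} (\<lambda>x. \<psi> (F x))" using cF by (simp add: X_def)
    show "continuous_on {x \<in> unit_cube. r / 2 \<le> D x} g" by (rule continuous_on_subset[OF g]) auto
    show "\<psi> (F x) = g x" if "x \<in> unit_cube" "D x = r / 2" for x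
    proof -
      have "\<theta> x = 0" unfolding \<theta>_def that(2) using r by simp
      then show ?thesis using \<psi>[OF gS[of x]] that by (simp add: F_def X_def)
    qed
  qed (rule Dc)
  moreover have "norm (h x - g x) < \<epsilon> \<and> (h x \<in> W \<longrightarrow> u x = 0)" if x: "x \<in> unit_cube" for x
  proof (cases "D x \<le> r / 2")
    case True
    then have xX: "x \<in> X" using x by (simp add: X_def)
    have h: "h x \<in> ?S" "\<phi> (h x) = F x" using \<psi>'[OF FS(2)[OF xX]] True by (simp_all add: h_def)
    have "\<mu> * norm (h x - g x) < \<mu> * \<epsilon>"
      using lo(2)[OF h(1) gS[OF xX]] FS(1)[OF xX] by (simp add: h(2))
    then have lt: "norm (h x - g x) < \<epsilon>" using lo(1) by simp
    \<comment> \<open>A point that is moved into \<open>W\<close> started within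
      \<open>\<epsilon> \<le> r / 4\<close> of it, where the cut-off is \<open>1\<close> and the
      replacement is complete.\<close>
    have "u x = 0" if hW: "h x \<in> W"
    proof -
      have "D x \<le> dist (g x) (h x)" unfolding D_def by (rule infdist_le[OF hW])
      then have "D x \<le> r / 4" using lt \<epsilon>(2) by (simp add: dist_norm norm_minus_commute)
      then have "\<theta> x = 1" using r by (simp add: \<theta>_def field_simps)
      then have "F x = \<phi> (g x) + (u x - ?q (\<phi> (g x)))" by (simp add: F_def)
      then have "?q (F x) = u x"
        by (simp add: linear_add[OF linear_coord_proj] linear_diff[OF linear_coord_proj] u(2))
      moreover have "?q (F x) = 0" using \<phi>W hW h(2) coord_proj_eq_0 by (metis image_subset_iff)
      ultimately show ?thesis by simp
    qed
    then show ?thesis using lt by blast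
  next
    case False
    then have "h x = g x" by (simp add: h_def)
    moreover have "g x \<notin> W" using False r by (auto simp: D_def)
    ultimately show ?thesis using \<epsilon> by simp
  qed
  ultimately show ?thesis by blast
qed

text \<open>The points \<open>g x\<close> close to \<open>W\<close> have a compact image in the open
  range of the chart, so a neighbourhood of uniform size fits. This gives one of the thresholds for
  \<open>\<epsilon>\<close>.\<close>

lemma ex_chart_room:
  fixes g :: "real ^ 'd::finite \<Rightarrow> real ^ 'm::finite"
  assumes W: "global_C1_manifold W p P r \<phi>" and ne: "W \<noteq> {}" and g: "continuous_on unit_cube g"
  shows "\<exists>\<eta>>0. \<forall>x\<in>unit_cube. infdist (g x) W \<le> r / 2 \<longrightarrow> ball (\<phi> (g x)) \<eta> \<subseteq> \<phi> ` tube W r"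
proof -
  let ?X = "{x \<in> unit_cube. infdist (g x) W \<le> r / 2}"
  have r: "0 < r" and op: "open (\<phi> ` tube W r)" and C1: "C1_on \<phi> (tube W r)"
    using W by (auto simp: global_C1_manifold_def C1_diffeomorphism_on_def)
  have gS: "g ` ?X \<subseteq> tube W r"
    using infdist_less_imp_tube[OF ne, of _ r] r by force
  have "closedin (top_of_set unit_cube) (unit_cube \<inter> (\<lambda>x. infdist (g x) W) -` {..r / 2})"
    by (intro continuous_closedin_preimage continuous_on_infdist g) auto
  then have "closed (unit_cube \<inter> (\<lambda>x. infdist (g x) W) -` {..r / 2})"
    using closedin_closed_trans closed_cbox by blast
  moreover have "?X = unit_cube \<inter> (unit_cube \<inter> (\<lambda>x. infdist (g x) W) -` {..r / 2})" by auto
  ultimately have "compact ?X" by (metis compact_Int_closed compact_cbox)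
  moreover have "continuous_on ?X g" by (rule continuous_on_subset[OF g]) auto
  ultimately have "compact (g ` ?X)" by (intro compact_continuous_image)
  then have K: "compact (\<phi> ` g ` ?X)"
    by (rule compact_continuous_image[OF continuous_on_subset[OF C1_on_imp_continuous_on[OF C1] gS]])
  obtain \<eta> where "0 < \<eta>" "(\<Union>x\<in>\<phi> ` g ` ?X. ball x \<eta>) \<subseteq> \<phi> ` tube W r"
    by (rule compact_subset_open_imp_ball_epsilon_subset[OF K op image_mono[OF gS]])
  then have "ball (\<phi> (g x)) \<eta> \<subseteq> \<phi> ` tube W r" if "x \<in> ?X" for x
    using that by (meson UN_upper imageI order_trans)
  then show ?thesis using \<open>0 < \<eta>\<close> by (intro exI[of _ \<eta>]) simp
qed

section \<open>The inverse modulus of continuity\<close>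

lemma less_inv_modulusD:
  assumes "ennreal t < inv_modulus g s" "x \<in> unit_cube" "y \<in> unit_cube" "norm (x - y) \<le> t"
  shows "norm (g x - g y) \<le> s"
proof -
  obtain \<delta> where \<delta>: "0 \<le> \<delta>" "\<forall>x\<in>unit_cube. \<forall>y\<in>unit_cube. norm (x - y) \<le> \<delta> \<longrightarrow> norm (g x - g y) \<le> s"
    "ennreal t < ennreal \<delta>"
    using assms(1) by (auto simp: inv_modulus_def less_SUP_iff)
  have "t < \<delta>"
    using \<delta>(1,3) by (metis ennreal_leI linorder_not_le)
  then show ?thesis using \<delta>(2) assms by (meson less_imp_le order_trans)
qed

lemma inv_modulus_pos:
  fixes g :: "real ^ 'd::finite \<Rightarrow> real ^ 'm::finite"
  assumes g: "continuous_on unit_cube g" and s: "0 < s"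
  shows "0 < inv_modulus g s"
proof -
  have "uniformly_continuous_on unit_cube g"
    by (rule compact_uniformly_continuous[OF g compact_cbox])
  then obtain \<delta> where \<delta>: "\<delta> > 0" "\<And>x y. x \<in> unit_cube \<Longrightarrow> y \<in> unit_cube \<Longrightarrow> dist y x < \<delta> \<Longrightarrow> dist (g y) (g x) < s"
    using s unfolding uniformly_continuous_on_def by metis
  have "ennreal (\<delta> / 2) \<le> inv_modulus g s"
    unfolding inv_modulus_def
  proof (rule SUP_upper)
    have "norm (g x - g y) \<le> s" if "x \<in> unit_cube" "y \<in> unit_cube" "norm (x - y) \<le> \<delta> / 2" for x y
      using \<delta>(2)[OF that(2,1)] \<delta>(1) that(3) by (simp add: dist_norm)
    then show "\<delta> / 2 \<in> {\<delta>. 0 \<le> \<delta> \<and> (\<forall>x\<in>unit_cube. \<forall>y\<in>unit_cube. norm (x - y) \<le> \<delta> \<longrightarrow> norm (g x - g y) \<le> s)}"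
      using \<delta>(1) by auto
  qed
  moreover have "0 < ennreal (\<delta> / 2)" using \<delta>(1) by simp
  ultimately show ?thesis by (rule less_le_trans[rotated])
qed

text \<open>If \<open>g x \<noteq> g y\<close>, the segment from \<open>x\<close> to
  \<open>y\<close> is cut into \<open>k\<close> steps of length at most
  \<open>sqrt CARD('d) / k\<close>. An admissible \<open>\<delta>\<close> above that length would
  bound \<open>norm (g y - g x)\<close> by \<open>k * s\<close>, which fails for small
  \<open>s\<close>. If \<open>g\<close> is constant on the cube, the inverse modulus is infinite for
  every \<open>s \<ge> 0\<close>.\<close>

lemma inv_modulus_small:
  fixes g :: "real ^ 'd::finite \<Rightarrow> real ^ 'm::finite" and k :: nat
  assumes k: "0 < k"
  shows "\<exists>s0>0. \<forall>s<s0. inv_modulus g s \<noteq> \<infinity> \<longrightarrow> inv_modulus g s \<le> ennreal (sqrt CARD('d) / k)"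
proof (cases "\<exists>x\<in>unit_cube. \<exists>y\<in>unit_cube. g x \<noteq> g y")
  case False
  then have c: "\<And>x y. x \<in> unit_cube \<Longrightarrow> y \<in> unit_cube \<Longrightarrow> g x = g y" by blast
  have "inv_modulus g s = \<infinity>" if s: "0 \<le> s" for s
  proof -
    have "real n \<in> {\<delta>. 0 \<le> \<delta> \<and> (\<forall>x\<in>unit_cube. \<forall>y\<in>unit_cube. norm (x - y) \<le> \<delta> \<longrightarrow> norm (g x - g y) \<le> s)}" for n
    proof -
      have "norm (g x - g y) \<le> s" if "x \<in> unit_cube" "y \<in> unit_cube" for x y
        using c[OF that] s by simp
      then show ?thesis by (simp only: mem_Collect_eq of_nat_0_le_iff) blast
    qed
    then have le: "ennreal (real n) \<le> inv_modulus g s" for n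
      unfolding inv_modulus_def by (rule SUP_upper)
    show ?thesis
    proof (rule ccontr)
      assume "inv_modulus g s \<noteq> \<infinity>"
      then obtain n where "inv_modulus g s < of_nat n"
        using ennreal_Ex_less_of_nat[of "inv_modulus g s"] by (auto simp: less_top)
      then show False using le[of n] by (simp add: ennreal_of_nat_eq_real_of_nat)
    qed
  qed
  \<comment> \<open>For negative \<open>s\<close> no \<open>\<delta>\<close> is admissible, as
    already a pair of equal points violates the bound; the supremum of the empty set is
    \<open>0\<close>.\<close>
  moreover have "inv_modulus g s \<le> 0" if s: "s < 0" for s
  proof -
    have "{\<delta>. 0 \<le> \<delta> \<and> (\<forall>x\<in>unit_cube. \<forall>y\<in>unit_cube. norm (x - y) \<le> \<delta> \<longrightarrow> norm (g x - g y) \<le> s)} = {}"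
    proof -
      have "(0 :: real^'d) \<in> unit_cube" by (simp add: mem_box_cart)
      then show ?thesis using s by (auto intro!: bexI[of _ 0])
    qed
    then show ?thesis unfolding inv_modulus_def by (simp only: image_empty Sup_empty bot_ennreal order_refl)
  qed
  ultimately show ?thesis by (intro exI[of _ 1]) (metis le_less_linear order_trans zero_le zero_less_one)
next
  case True
  then obtain x y where xy: "x \<in> unit_cube" "y \<in> unit_cube" "g x \<noteq> g y" by blast
  let ?s0 = "norm (g y - g x) / k"
  have "inv_modulus g s \<le> ennreal (sqrt CARD('d) / k)" if s: "s < ?s0" for s
    unfolding inv_modulus_def
  proof (rule SUP_least)
    fix \<delta> assume "\<delta> \<in> {\<delta>. 0 \<le> \<delta> \<and> (\<forall>x\<in>unit_cube. \<forall>y\<in>unit_cube. norm (x - y) \<le> \<delta> \<longrightarrow> norm (g x - g y) \<le> s)}"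
    then have \<delta>: "\<And>x y. x \<in> unit_cube \<Longrightarrow> y \<in> unit_cube \<Longrightarrow> norm (x - y) \<le> \<delta> \<Longrightarrow> norm (g x - g y) \<le> s" by blast
    have "\<delta> \<le> sqrt CARD('d) / k"
    proof (rule ccontr)
      assume "\<not> \<delta> \<le> sqrt CARD('d) / k"
      then have big: "sqrt CARD('d) / k < \<delta>" by simp
      define pt where "pt j = x + (real j / real k) *\<^sub>R (y - x)" for j :: nat
      have pt: "pt j \<in> unit_cube" if "j \<le> k" for j
      proof -
        have "pt j = (1 - real j / real k) *\<^sub>R x + (real j / real k) *\<^sub>R y"
          by (simp add: pt_def algebra_simps)
        moreover have "(1 - real j / real k) *\<^sub>R x + (real j / real k) *\<^sub>R y \<in> unit_cube"
          using that k by (intro convexD[OF convex_box(1) xy(1,2)]) auto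
        ultimately show ?thesis by simp
      qed
      have "norm (y - x) \<le> sqrt CARD('d) * 1"
      proof (rule norm_le_sqrt_card)
        have "0 \<le> x $ i" "x $ i \<le> 1" "0 \<le> y $ i" "y $ i \<le> 1" for i
          using xy(1,2) by (auto simp: mem_unit_cube_iff)
        then show "\<bar>(y - x) $ i\<bar> \<le> 1" for i by (simp add: abs_le_iff) (smt (verit))
      qed simp
      then have "norm (y - x) / k < \<delta>"
        using big k by (smt (verit) divide_right_mono of_nat_0_le_iff mult.right_neutral)
      moreover have "pt (Suc j) - pt j = (1 / real k) *\<^sub>R (y - x)" for j
        by (simp add: pt_def add_divide_distrib algebra_simps)
      ultimately have step: "norm (g (pt (Suc j)) - g (pt j)) \<le> s" if "j < k" for j
        using \<delta>[OF pt[of "Suc j"] pt[of j]] that by simp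
      have "norm (g (pt j) - g (pt 0)) \<le> real j * s" if "j \<le> k" for j
        using that
      proof (induction j)
        case (Suc j)
        then have "norm (g (pt (Suc j)) - g (pt 0)) \<le> s + real j * s"
          using norm_triangle_ineq[of "g (pt (Suc j)) - g (pt j)" "g (pt j) - g (pt 0)"] step[of j] by simp
        then show ?case by (simp add: algebra_simps)
      qed simp
      from this[of k] have "norm (g y - g x) \<le> k * s" using k by (simp add: pt_def)
      then show False using s k by (simp add: field_simps)
    qed
    then show "ennreal \<delta> \<le> ennreal (sqrt CARD('d) / k)" by (rule ennreal_leI)
  qed
  moreover have "0 < ?s0" using xy(3) k by simp
  ultimately show ?thesis by blast
qed

text \<open>The minimum in \<open>covering_number\<close> is attained because bounded sets are
  totally bounded, so that some finite cover exists.\<close>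

lemma ex_cover_covering_number:
  fixes K :: "'a::euclidean_space set"
  assumes "bounded K" "0 < \<eta>"
  shows "\<exists>\<C>. finite \<C> \<and> card \<C> = covering_number \<eta> K \<and> K \<subseteq> \<Union>\<C> \<and> (\<forall>A\<in>\<C>. bounded A \<and> diameter A \<le> 2 * \<eta>)"
proof -
  have "compact (closure K)" using assms(1) by (simp add: compact_closure)
  then obtain F where F: "finite F" "closure K \<subseteq> (\<Union>x\<in>F. ball x \<eta>)"
    using assms(2) unfolding compact_eq_totally_bounded by blast
  have "diameter (ball x \<eta>) \<le> 2 * \<eta>" for x :: 'a
  proof (rule diameter_le)
    fix y z assume "y \<in> ball x \<eta>" "z \<in> ball x \<eta>"
    then show "norm (y - z) \<le> 2 * \<eta>"
      using norm_triangle_ineq4[of "x - z" "x - y"] by (simp add: dist_norm)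
  qed (use assms(2) in simp)
  then have "\<exists>n. \<exists>\<C>. finite \<C> \<and> card \<C> = n \<and> K \<subseteq> \<Union>\<C> \<and> (\<forall>A\<in>\<C>. bounded A \<and> diameter A \<le> 2 * \<eta>)"
    using F closure_subset[of K]
    by (intro exI[of _ "card ((\<lambda>x. ball x \<eta>) ` F)"] exI[of _ "(\<lambda>x. ball x \<eta>) ` F"]) auto
  then show ?thesis
    unfolding covering_number_def by (rule LeastI_ex)
qed

lemma two_to_kolmogorov_entropy: "two_to (kolmogorov_entropy \<eta> K) = real (covering_number \<eta> K)"
  by (simp add: two_to_def kolmogorov_entropy_def)

subsection \<open>The perturbation\<close>

lemma C0_norm_le:
  fixes f :: "real ^ 'd::finite \<Rightarrow> real ^ 'm::finite"
  assumes "\<And>x. x \<in> unit_cube \<Longrightarrow> norm (f x) \<le> \<epsilon>"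
  shows "C0_norm f \<le> \<epsilon>"
proof -
  have "(0 :: real ^ 'd) \<in> unit_cube" by (simp add: mem_unit_cube_iff)
  then show ?thesis unfolding C0_norm_def using assms by (intro cSUP_least) auto
qed

lemma min_preimage_measure_le:
  assumes "continuous_on unit_cube h" "\<And>x. x \<in> unit_cube \<Longrightarrow> norm (h x - g x) \<le> \<epsilon>"
    and "has_fine_covers s B (preimage_set W h)"
  shows "min_preimage_measure s W g \<epsilon> \<le> ennreal B"
  unfolding min_preimage_measure_def
  using assms by (intro INF_lower2[where i = h] hausdorff_measure_le) (auto intro: C0_norm_le)

lemma grid_interp_invariant:
  assumes "linear q" "\<And>v. q (c v) = c v"
  shows "q (grid_interp N c x) = grid_interp N c x"
  unfolding grid_interp_def by (simp add: linear_sum[OF assms(1)] linear_cmul[OF assms(1)] assms(2))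

text \<open>The error allowed in the chart is \<open>s = \<mu> * \<epsilon>\<close>. Interpolation
  uses \<open>\<kappa> * s\<close> with \<open>\<kappa> < 1\<close>, and the remaining
  \<open>(1 - \<kappa>) * s\<close> is spent on the generic translation \<open>y\<close>. The
  preimage of \<open>W\<close> under the resulting \<open>h\<close> then lies in the level set
  \<open>grid_interp N c x = y\<close>, to which the count of simplices applies.\<close>

lemma ex_perturbation_fine_covers:
  fixes g :: "real ^ 'd::finite \<Rightarrow> real ^ 'm::finite"
  assumes W: "global_C1_manifold W p P r \<phi>" "W \<noteq> {}" and g: "continuous_on unit_cube g"
    and \<mu>: "0 < \<mu>" "\<mu> \<le> \<nu>"
    and lo: "\<And>x y. x \<in> tube W r \<Longrightarrow> y \<in> tube W r \<Longrightarrow> \<mu> * norm (x - y) \<le> norm (\<phi> x - \<phi> y)"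
    and up: "\<And>x y. x \<in> tube W r \<Longrightarrow> y \<in> tube W r \<Longrightarrow> norm (\<phi> x - \<phi> y) \<le> \<nu> * norm (x - y)"
    and \<epsilon>: "0 < \<epsilon>" "\<epsilon> < r / 4"
    and mod: "\<And>x y. x \<in> unit_cube \<Longrightarrow> y \<in> unit_cube \<Longrightarrow> norm (x - y) < L \<Longrightarrow> norm (g x - g y) \<le> \<mu> / \<nu> * \<epsilon>"
    and room: "\<And>x. x \<in> unit_cube \<Longrightarrow> infdist (g x) W \<le> r / 2 \<Longrightarrow> ball (\<phi> (g x)) (\<mu> * \<epsilon>) \<subseteq> \<phi> ` tube W r"
    and N: "0 < N" "sqrt CARD('d) / N < L" "sqrt CARD('d) / (real N + 1) < L / 2"
      "2 ^ CARD('d) * (2 * (1 / (real N + 1))) < 1 / 32"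
    and n: "n + card (- P) = CARD('d)"
  shows "\<exists>h. continuous_on unit_cube h \<and> (\<forall>x\<in>unit_cube. norm (h x - g x) \<le> \<epsilon>) \<and>
    has_fine_covers (real n)
      (real (card {z\<in>cells N. {x \<in> unit_cube. g x \<in> tube (closure W) \<epsilon>} \<inter> cell_box N z \<noteq> {}}) *
        (fact CARD('d) * (sqrt n * (sqrt CARD('d) / N)) ^ n)) (preimage_set W h)"
proof -
  let ?q = "coord_proj (- P)"
  define f where "f x = ?q (\<phi> (g x))" for x
  define X0 where "X0 = {x \<in> unit_cube. infdist (g x) W \<le> r / 2}"
  define X1 where "X1 = {x \<in> unit_cube. infdist (g x) W < r}"
  define s where "s = \<mu> * \<epsilon>"
  define \<kappa> where "\<kappa> = 31 / 32 + 2 ^ CARD('d) * (2 * (1 / (real N + 1)))"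
  have s: "0 < s" using \<mu> \<epsilon> by (simp add: s_def)
  have \<kappa>: "\<kappa> < 1" using N(4) unfolding \<kappa>_def by linarith
  have gS: "g x \<in> tube W r" if "x \<in> X1" for x
    using that infdist_less_imp_tube[OF W(2)] by (simp add: X1_def)
  \<comment> \<open>The upper dilation \<open>\<nu>\<close> cancels the denominator of
    \<open>\<mu> / \<nu>\<close>; what remains is exactly the error
    \<open>\<mu> * \<epsilon>\<close> that the lower dilation turns into
    \<open>\<epsilon>\<close>.\<close>
  have f: "norm (f x - f y) \<le> s" if xy: "x \<in> X1" "y \<in> X1" "norm (x - y) < L" for x y
  proof -
    have "f x - f y = ?q (\<phi> (g x) - \<phi> (g y))"
      by (simp add: f_def linear_diff[OF linear_coord_proj])
    then have "norm (f x - f y) \<le> norm (\<phi> (g x) - \<phi> (g y))" by (simp add: norm_coord_proj_le)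
    also have "\<dots> \<le> \<nu> * norm (g x - g y)" by (rule up[OF gS[OF xy(1)] gS[OF xy(2)]])
    also have "\<dots> \<le> \<nu> * (\<mu> / \<nu> * \<epsilon>)"
      using mod[of x y] xy \<mu> by (intro mult_left_mono) (auto simp: X1_def)
    also have "\<dots> = s" using \<mu> by (simp add: s_def)
    finally show ?thesis .
  qed
  have mod': "norm (g x - g y) \<le> \<epsilon>" if "x \<in> unit_cube" "y \<in> unit_cube" "norm (x - y) < L" for x y
  proof -
    have "\<mu> / \<nu> * \<epsilon> \<le> 1 * \<epsilon>" using \<mu> \<epsilon> by (intro mult_right_mono) auto
    then show ?thesis using mod[OF that] by simp
  qed
  have L: "0 < L" using N(2) by (smt (verit) divide_nonneg_nonneg of_nat_0_le_iff real_sqrt_ge_zero)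
  \<comment> \<open>Going from \<open>x\<close> to \<open>v\<close> and from \<open>v\<close> to
    \<open>y\<close> changes the distance to \<open>W\<close> by at most \<open>\<epsilon>\<close>
    each time, and \<open>r / 2 + 2 * \<epsilon> < r\<close>.\<close>
  have X1: "{y \<in> unit_cube. norm (y - v) < L / 2} \<subseteq> X1"
    if x: "x \<in> X0" "v \<in> unit_cube" "norm (x - v) < L" for x v
  proof clarify
    fix y assume y: "y \<in> unit_cube" "norm (y - v) < L / 2"
    have "infdist (g y) W \<le> infdist (g x) W + dist (g y) (g x)" by (rule infdist_triangle)
    also have "dist (g y) (g x) \<le> dist (g y) (g v) + dist (g v) (g x)" by (rule dist_triangle)
    also have "dist (g y) (g v) \<le> \<epsilon>" using mod'[OF y(1) x(2)] y(2) L by (simp add: dist_norm)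
    also have "dist (g v) (g x) \<le> \<epsilon>"
      using mod'[of x v] x by (simp add: X0_def dist_norm norm_minus_commute)
    also have "infdist (g x) W \<le> r / 2" using x(1) by (simp add: X0_def)
    finally have "infdist (g y) W < r" using \<epsilon>(2) by simp
    then show "y \<in> X1" using y(1) by (simp add: X1_def)
  qed
  have "\<exists>c. (\<forall>v. ?q (c v) = c v) \<and> (\<forall>x\<in>X0. norm (grid_interp N c x - f x) \<le> \<kappa> * s)"
    unfolding \<kappa>_def
    by (rule ex_grid_values[OF linear_coord_proj _ X1 _ f N(1-3) less_imp_le[OF s]])
      (simp_all add: f_def X0_def)
  then obtain c where c: "\<And>v. ?q (c v) = c v"
    "\<And>x. x \<in> X0 \<Longrightarrow> norm (grid_interp N c x - f x) \<le> \<kappa> * s" by blast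
  have "0 < (1 - \<kappa>) * s" using \<kappa> s by simp
  then have "\<exists>y. ?q y = y \<and> norm y < (1 - \<kappa>) * s \<and> (\<forall>z\<in>grid N. \<forall>xs\<in>permutations_of_set UNIV.
      has_fine_covers (real n) ((sqrt n * (sqrt CARD('d) / N)) ^ n)
        {x. real N *\<^sub>R x \<in> kuhn_cell z xs \<and> grid_interp N c x = y})"
    using n by (intro generic_level_set_covers[OF linear_coord_proj coord_proj_idem norm_coord_proj_le c(1) _ N(1)])
      (simp_all add: dim_range_coord_proj)
  then obtain y where y: "?q y = y" "norm y < (1 - \<kappa>) * s"
    "\<And>z xs. z \<in> grid N \<Longrightarrow> xs \<in> permutations_of_set UNIV \<Longrightarrow>
      has_fine_covers (real n) ((sqrt n * (sqrt CARD('d) / N)) ^ n)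
        {x. real N *\<^sub>R x \<in> kuhn_cell z xs \<and> grid_interp N c x = y}"
    by blast
  define u where "u x = grid_interp N c x - y" for x
  have "\<exists>h. continuous_on unit_cube h \<and> (\<forall>x\<in>unit_cube. norm (h x - g x) < \<epsilon> \<and> (h x \<in> W \<longrightarrow> u x = 0))"
  proof (rule ex_perturbation[OF W \<mu>(1) lo g])
    show "continuous_on unit_cube u"
      unfolding u_def by (intro continuous_intros continuous_on_grid_interp)
    show "?q (u x) = u x" for x
      by (simp add: u_def linear_diff[OF linear_coord_proj] y(1) grid_interp_invariant[OF linear_coord_proj c(1)])
    show "norm (u x - ?q (\<phi> (g x))) < \<mu> * \<epsilon>" if "x \<in> unit_cube" "infdist (g x) W \<le> r / 2" for x
    proof -
      have "norm (u x - f x) \<le> norm (grid_interp N c x - f x) + norm y"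
        using norm_triangle_ineq4[of "grid_interp N c x - f x" y] by (simp add: u_def algebra_simps)
      also have "\<dots> < \<kappa> * s + (1 - \<kappa>) * s"
        using c(2)[of x] y(2) that by (intro add_le_less_mono) (auto simp: X0_def)
      finally show ?thesis by (simp add: f_def s_def algebra_simps)
    qed
  qed (use \<epsilon> room in auto)
  then obtain h where h: "continuous_on unit_cube h"
    "\<And>x. x \<in> unit_cube \<Longrightarrow> norm (h x - g x) < \<epsilon> \<and> (h x \<in> W \<longrightarrow> u x = 0)" by blast
  let ?G = "{x \<in> unit_cube. g x \<in> tube (closure W) \<epsilon>}"
  let ?Z = "preimage_set W h"
  \<comment> \<open>The strict estimate for \<open>h\<close> matters here, since \<open>tube\<close>
    is made of open balls.\<close>
  have ZG: "?Z \<subseteq> ?G"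
  proof
    fix x assume x: "x \<in> ?Z"
    then have "g x \<in> ball (h x) \<epsilon>" "h x \<in> closure W"
      using h(2)[of x] closure_subset[of W] by (auto simp: preimage_set_def dist_norm)
    then show "x \<in> ?G" using x unfolding tube_def preimage_set_def by blast
  qed
  have "has_fine_covers (real n) (real (card {z\<in>cells N. ?Z \<inter> cell_box N z \<noteq> {}}) *
        (fact CARD('d) * (sqrt n * (sqrt CARD('d) / N)) ^ n)) ?Z"
  proof (rule level_set_covers[OF N(1)])
    show "grid_interp N c x = y" if "x \<in> ?Z" for x
      using that h(2)[of x] by (simp add: preimage_set_def u_def)
  qed (use y(3) in \<open>auto simp: preimage_set_def\<close>)
  moreover have "card {z\<in>cells N. ?Z \<inter> cell_box N z \<noteq> {}} \<le> card {z\<in>cells N. ?G \<inter> cell_box N z \<noteq> {}}"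
    using ZG by (intro card_mono finite_subset[OF _ finite_cells[of N]]) blast+
  ultimately have "has_fine_covers (real n) (real (card {z\<in>cells N. ?G \<inter> cell_box N z \<noteq> {}}) *
        (fact CARD('d) * (sqrt n * (sqrt CARD('d) / N)) ^ n)) ?Z"
    by (elim has_fine_covers_mono) (auto intro!: mult_right_mono)
  then show ?thesis using h by (intro exI[of _ h]) (simp add: less_imp_le)
qed

section \<open>Numerical estimates\<close>

lemma const_eq_sqrt_power:
  assumes "n + k = d" "0 < d"
  shows "real d powr (real d - real k / 2) = sqrt d ^ (d + n)"
proof -
  have "sqrt d ^ (d + n) = (real d powr (1 / 2)) powr (real (d + n))"
    using assms by (subst powr_realpow) (simp_all add: powr_half_sqrt)
  \<comment> \<open>Here \<open>2 * d - k = d + n\<close>.\<close>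
  also have "\<dots> = real d powr (real d - real k / 2)"
    using assms by (simp add: powr_powr field_simps flip: assms(1))
  finally show ?thesis by simp
qed

text \<open>Serves the term \<open>1\<close> of the minimum in \<open>Lambda\<close>, with
  \<open>D = sqrt d\<close>. Of the \<open>N ^ d\<close> cubes, a factor \<open>N ^ n\<close>
  cancels against the size of the pieces, and the remaining \<open>N ^ k\<close> is at most
  \<open>(2 * D / L) ^ k\<close>.\<close>

lemma bound_by_all_cells:
  fixes D L \<nu> :: real
  assumes nk: "n + k = d" "0 < k" and D: "1 \<le> D" "sqrt n \<le> D" and L: "0 < L"
    and N: "0 < N" "real N \<le> 2 * D / L" and K: "K \<le> real N ^ d"
  shows "K * (fact d * (sqrt n * (D / N)) ^ n) \<le> 2 ^ (d + k - 1) * fact d * D ^ (d + n) * (1 / L) ^ k"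
proof -
  have "(sqrt n * (D / N)) ^ n \<le> (D * (D / N)) ^ n"
    using D by (intro power_mono mult_right_mono) auto
  then have "K * (fact d * (sqrt n * (D / N)) ^ n) \<le> real N ^ d * (fact d * (D * (D / N)) ^ n)"
    using K D by (intro mult_mono mult_left_mono) auto
  also have "\<dots> = fact d * D ^ (n + n) * real N ^ k"
    using N(1) by (simp add: power_mult_distrib power_divide power_add flip: nk(1))
  also have "\<dots> \<le> fact d * D ^ (n + n) * (2 * D / L) ^ k"
    using N D by (intro mult_left_mono power_mono) auto
  also have "\<dots> = 2 ^ k * (fact d * D ^ (d + n) * (1 / L) ^ k)"
    by (simp add: power_mult_distrib power_divide power_add mult_ac flip: nk(1))
  also have "\<dots> \<le> 2 ^ (d + k - 1) * (fact d * D ^ (d + n) * (1 / L) ^ k)"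
    using nk L D by (intro mult_right_mono power_increasing) auto
  finally show ?thesis by (simp add: mult_ac)
qed

text \<open>Serves the entropy term of \<open>Lambda\<close>: there are \<open>4 ^ d\<close> cubes
  for each of the \<open>M\<close> covering sets, and \<open>D / N \<le> L\<close>. The factor
  \<open>4 ^ d\<close> fits into \<open>2 ^ (d + k - 1)\<close> times the \<open>2 ^ d\<close> in
  \<open>(2 * L / D) ^ d\<close> because \<open>k \<ge> 1\<close>.\<close>

lemma bound_by_entropy_cells:
  fixes D L M :: real
  assumes nk: "n + k = d" "0 < k" and D: "1 \<le> D" "sqrt n \<le> D" and L: "0 < L"
    and N: "0 < N" "1 / real N \<le> L / D" and K: "K \<le> M * 4 ^ d" and M: "0 \<le> M"
  shows "K * (fact d * (sqrt n * (D / N)) ^ n) \<le>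
    2 ^ (d + k - 1) * fact d * D ^ (d + n) * ((2 * L / D) ^ d * M) * (1 / L) ^ k"
proof -
  have "D / N \<le> L" using N D by (simp add: field_simps)
  then have "(sqrt n * (D / N)) ^ n \<le> (D * L) ^ n"
    using D by (intro power_mono mult_mono) auto
  then have "K * (fact d * (sqrt n * (D / N)) ^ n) \<le> M * 4 ^ d * (fact d * (D * L) ^ n)"
    using K D M by (intro mult_mono mult_left_mono) auto
  also have "\<dots> = 2 ^ (d + d) * (fact d * (D * L) ^ n * M)"
    by (simp add: power_add flip: power_mult_distrib)
  also have "\<dots> \<le> 2 ^ (d + d + k - 1) * (fact d * (D * L) ^ n * M)"
    using nk L D M by (intro mult_right_mono power_increasing) auto
  also have "2 ^ (d + d + k - 1) = (2 ^ (d + k - 1) * 2 ^ d :: real)"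
    using nk by (simp flip: power_add)
  also have "\<dots> * (fact d * (D * L) ^ n * M) =
      2 ^ (d + k - 1) * fact d * D ^ (d + n) * ((2 * L / D) ^ d * M) * (1 / L) ^ k"
  proof -
    have "D ^ (d + n) * (2 * L / D) ^ d * (1 / L) ^ k = 2 ^ d * (D * L) ^ n"
      using L D by (simp add: power_mult_distrib power_divide power_add flip: nk(1))
    then show ?thesis by (simp add: mult_ac)
  qed
  finally show ?thesis .
qed

lemma has_fine_covers_full_dim:
  fixes A :: "(real ^ 'd::finite) set"
  assumes "bounded A" "diameter A \<le> D" "0 \<le> D"
  shows "has_fine_covers (real CARD('d)) ((sqrt CARD('d) * D) ^ CARD('d)) A"
proof (rule has_fine_covers_affine[where K = UNIV])
  show "norm (x - y) \<le> D" if "x \<in> A" "y \<in> A" for x y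
    using diameter_bounded_bound[OF assms(1) that] assms(2) by (simp add: dist_norm)
qed (use assms(3) in \<open>auto simp: dim_UNIV\<close>)

section \<open>Choice of the thresholds and of the mesh\<close>

theorem theorem3p2:
  fixes g :: "real ^ 'd::finite \<Rightarrow> real ^ 'm::finite"
    and W :: "(real ^ 'm) set"
    and \<phi> :: "real ^ 'm \<Rightarrow> real ^ 'm"
    and P :: "'m set"
    and r \<gamma> C :: real
    and d m p :: nat
  assumes d: "d = CARD('d)"
    and m: "m = CARD('m)"
    and pm: "p \<le> m"
    and pd: "m \<le> p + d"
    and g: "continuous_on unit_cube g"
    and W: "global_C1_manifold W p P r \<phi>"
    and \<gamma>: "\<gamma> = chart_gamma W r \<phi>"
    and C: "C = 2 ^ (d + m - p - 1) * fact d * real d powr (real d + (real p - real m) / 2)"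
  shows "\<exists>\<epsilon>0>0. \<forall>\<epsilon>. 0 < \<epsilon> \<and> \<epsilon> < \<epsilon>0 \<and> inv_modulus g (\<gamma> * \<epsilon>) \<le> ennreal (sqrt (real d)) \<longrightarrow>
           min_preimage_measure (real (d + p - m)) W g \<epsilon>
             \<le> ennreal (C * Lambda W g \<gamma> \<epsilon> *
                 (1 / enn2real (inv_modulus g (\<gamma> * \<epsilon>))) ^ (m - p))"
proof -
  obtain \<mu> \<nu> where \<mu>: "0 < \<mu>" "\<mu> \<le> \<nu>" "chart_gamma W r \<phi> = \<mu> / \<nu>" and ne: "W \<noteq> {}"
    and lo: "\<And>x y. x \<in> tube W r \<Longrightarrow> y \<in> tube W r \<Longrightarrow> \<mu> * norm (x - y) \<le> norm (\<phi> x - \<phi> y)"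
    and up: "\<And>x y. x \<in> tube W r \<Longrightarrow> y \<in> tube W r \<Longrightarrow> norm (\<phi> x - \<phi> y) \<le> \<nu> * norm (x - y)"
    by (rule global_C1_manifoldE[OF W]) (rule that; blast)
  have \<gamma>\<mu>: "\<gamma> = \<mu> / \<nu>" "0 < \<gamma>" using \<gamma> \<mu> by simp_all
  have r: "0 < r" and cP: "card P = p" using W by (auto simp: global_C1_manifold_def)
  define k where "k = m - p"
  define n where "n = d + p - m"
  have nk: "n + k = d" and dk: "d + m - p - 1 = d + k - 1" using pm pd by (auto simp: n_def k_def)
  have cQ: "card (- P) = k" using cP by (simp add: k_def m Compl_eq_Diff_UNIV card_Diff_subset)
  have d0: "0 < d" by (simp add: d)
  define D where "D = sqrt (real d)"
  have D: "1 \<le> D" "sqrt n \<le> D" using d0 nk by (auto simp: D_def)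
  have C': "C = 2 ^ (d + k - 1) * fact d * D ^ (d + n)"
  proof -
    have "real d + (real p - real m) / 2 = real d - real k / 2" using pm by (simp add: k_def of_nat_diff field_simps)
    then show ?thesis unfolding C dk D_def by (simp only: const_eq_sqrt_power[OF nk d0])
  qed
  obtain \<eta> where \<eta>: "0 < \<eta>"
    "\<And>x. x \<in> unit_cube \<Longrightarrow> infdist (g x) W \<le> r / 2 \<Longrightarrow> ball (\<phi> (g x)) \<eta> \<subseteq> \<phi> ` tube W r"
    using ex_chart_room[OF W ne g] by blast
  \<comment> \<open>From \<open>L \<le> D / k0\<close> follows
    \<open>N + 1 > k0 = 64 * 2 ^ d\<close>, so the contribution \<open>2 ^ d * (2 / (N + 1))\<close>
    of the far vertices is below the \<open>1 / 32\<close> that \<open>near_center\<close>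
    leaves.\<close>
  define k0 :: nat where "k0 = 2 ^ (d + 6)"
  obtain s0 where s0: "0 < s0" "\<And>s. s < s0 \<Longrightarrow> inv_modulus g s \<noteq> \<infinity> \<Longrightarrow> inv_modulus g s \<le> ennreal (D / k0)"
    using inv_modulus_small[of k0 g] by (auto simp: k0_def D_def d)
  \<comment> \<open>In this order: room for the cut-off, room in the range of the chart, and a
    sufficiently fine mesh.\<close>
  define \<epsilon>0 where "\<epsilon>0 = min (r / 4) (min (\<eta> / \<mu>) (s0 / \<gamma>))"
  have "min_preimage_measure (real n) W g \<epsilon>
      \<le> ennreal (C * Lambda W g \<gamma> \<epsilon> * (1 / enn2real (inv_modulus g (\<gamma> * \<epsilon>))) ^ k)"
    if \<epsilon>: "0 < \<epsilon>" "\<epsilon> < \<epsilon>0" "inv_modulus g (\<gamma> * \<epsilon>) \<le> ennreal (sqrt (real d))" for \<epsilon>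
  proof -
    define L where "L = enn2real (inv_modulus g (\<gamma> * \<epsilon>))"
    have \<epsilon>r: "\<epsilon> < r / 4" and \<epsilon>\<eta>: "\<mu> * \<epsilon> \<le> \<eta>" and \<epsilon>s: "\<gamma> * \<epsilon> < s0"
      using \<epsilon>(2) \<mu>(1) \<gamma>\<mu>(2) by (auto simp: \<epsilon>0_def field_simps)
    have fin: "inv_modulus g (\<gamma> * \<epsilon>) \<noteq> \<infinity>" using \<epsilon>(3) by (auto simp: top_unique)
    then have IL: "inv_modulus g (\<gamma> * \<epsilon>) = ennreal L" by (simp add: L_def less_top)
    have L: "0 < L"
      using inv_modulus_pos[OF g, of "\<gamma> * \<epsilon>"] \<epsilon>(1) \<gamma>\<mu>(2) by (simp add: IL)
    have LD: "L \<le> D / k0"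
      using s0(2)[OF \<epsilon>s fin] D by (simp add: IL ennreal_le_iff)
    have mod: "norm (g x - g y) \<le> \<mu> / \<nu> * \<epsilon>" if "x \<in> unit_cube" "y \<in> unit_cube" "norm (x - y) < L" for x y
    proof -
      have "ennreal (norm (x - y)) < inv_modulus g (\<gamma> * \<epsilon>)"
        unfolding IL using that(3) by (simp add: ennreal_less_iff)
      from less_inv_modulusD[OF this that(1,2)] show ?thesis by (simp add: \<gamma>\<mu>(1))
    qed
    define \<l> where "\<l> = scale_ell g \<gamma> \<epsilon>"
    have \<l>: "\<l> = L / (2 * D)" "0 < \<l>" using L D by (simp_all add: \<l>_def scale_ell_def L_def D_def d)
    let ?G = "{x \<in> unit_cube. g x \<in> tube (closure W) \<epsilon>}"
    define M where "M = covering_number \<l> ?G"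
    have "bounded ?G" by (rule bounded_subset[OF bounded_cbox]) blast
    from ex_cover_covering_number[OF this \<l>(2)]
    obtain \<C> where "finite \<C> \<and> card \<C> = M \<and> ?G \<subseteq> \<Union>\<C> \<and> (\<forall>A\<in>\<C>. bounded A \<and> diameter A \<le> 2 * \<l>)"
      unfolding M_def by (rule exE)
    then have \<C>: "finite \<C>" "card \<C> = M" "?G \<subseteq> \<Union>\<C>" "\<And>A. A \<in> \<C> \<Longrightarrow> bounded A \<and> diameter A \<le> 2 * \<l>"
      by simp_all
    have \<Lambda>: "Lambda W g \<gamma> \<epsilon> = min ((2 * L / D) ^ d * M) 1"
    proof -
      have "4 * \<l> = 2 * L / D" by (simp add: \<l>(1))
      then show ?thesis unfolding Lambda_def two_to_kolmogorov_entropy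
        by (simp add: M_def d flip: \<l>_def)
    qed
    \<comment> \<open>One bound for each term of the minimum in \<open>Lambda\<close>.\<close>
    have "min_preimage_measure (real n) W g \<epsilon> \<le> ennreal (C * ((2 * L / D) ^ d * M) * (1 / L) ^ k) \<and>
        min_preimage_measure (real n) W g \<epsilon> \<le> ennreal (C * (1 / L) ^ k)"
    \<comment> \<open>In codimension \<open>0\<close> the count of simplices would be too large by a
      factor \<open>2\<close>, since the constant only provides \<open>2 ^ (d - 1)\<close>. Instead
      \<open>h = g\<close>, and the sets of the entropy cover, or the whole cube, are covered
      directly.\<close>
    proof (cases "k = 0")
      case True
      then have n: "n = d" using nk by simp
      have C1: "fact d * D ^ (d + d) \<le> C"
      proof -
        have "1 * (fact d * D ^ (d + d)) \<le> 2 ^ (d + k - 1) * (fact d * D ^ (d + d))"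
          using D by (intro mult_right_mono) auto
        then show ?thesis by (simp add: C' n mult.assoc)
      qed
      have fd: "(1::real) \<le> fact d" by (simp add: fact_ge_1)
      let ?Z = "preimage_set W g"
      have ZG: "?Z \<subseteq> ?G"
        using \<epsilon>(1) closure_subset[of W] by (force simp: preimage_set_def tube_def)
      have "has_fine_covers (real d) (real (card \<C>) * (D * (2 * \<l>)) ^ d) (\<Union>A\<in>\<C>. A)"
        using \<C>(1,4) \<l>(2) unfolding D_def d
        by (intro has_fine_covers_UN has_fine_covers_full_dim) auto
      moreover have "D * (2 * \<l>) = L" using D by (simp add: \<l>(1))
      ultimately have "has_fine_covers (real d) (real M * L ^ d) (\<Union>A\<in>\<C>. A)" by (simp add: \<C>(2))
      moreover have "real M * L ^ d \<le> C * ((2 * L / D) ^ d * M)"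
      proof -
        have "1 * 1 * 1 \<le> fact d * 2 ^ d * D ^ d"
          using fd D by (intro mult_mono one_le_power) auto
        then have "1 * L ^ d \<le> (fact d * 2 ^ d * D ^ d) * L ^ d"
          using L by (intro mult_right_mono) auto
        also have "\<dots> = fact d * D ^ (d + d) * (2 * L / D) ^ d"
          using D by (simp add: power_add power_mult_distrib power_divide)
        also have "\<dots> \<le> C * (2 * L / D) ^ d" using C1 L D by (intro mult_right_mono) auto
        finally show ?thesis using mult_right_mono[of "L ^ d" "C * (2 * L / D) ^ d" "real M"] by (simp add: mult_ac)
      qed
      ultimately have 1: "has_fine_covers (real d) (C * ((2 * L / D) ^ d * M)) ?Z"
        using ZG \<C>(3) by (elim has_fine_covers_mono) auto
      have "diameter (unit_cube :: (real ^ 'd) set) \<le> D"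
      proof (rule diameter_le)
        fix x y :: "real ^ 'd" assume "x \<in> unit_cube" "y \<in> unit_cube"
        then have "0 \<le> x $ i" "x $ i \<le> 1" "0 \<le> y $ i" "y $ i \<le> 1" for i
          by (auto simp: mem_unit_cube_iff)
        then have "\<bar>(x - y) $ i\<bar> \<le> 1" for i by (simp add: abs_le_iff) (smt (verit))
        then show "norm (x - y) \<le> D" using norm_le_sqrt_card[of "x - y" 1] by (simp add: D_def d)
      qed (use D in simp)
      then have "has_fine_covers (real d) ((D * D) ^ d) (unit_cube :: (real ^ 'd) set)"
        using D unfolding D_def d by (intro has_fine_covers_full_dim) auto
      moreover have "(D * D) ^ d \<le> C"
      proof -
        have "1 * D ^ (d + d) \<le> fact d * D ^ (d + d)" using fd D by (intro mult_right_mono) auto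
        then show ?thesis using C1 by (simp add: power_add power_mult_distrib)
      qed
      ultimately have 2: "has_fine_covers (real d) C ?Z"
        by (elim has_fine_covers_mono) (auto simp: preimage_set_def)
      show ?thesis
        using min_preimage_measure_le[OF g _ 1] min_preimage_measure_le[OF g _ 2] \<epsilon>(1) True by (simp add: n)
    next
      case False
      then have k: "0 < k" by simp
      \<comment> \<open>The largest \<open>N\<close> with \<open>2 * \<l> \<le> 2 / N\<close>, the
        condition for the count of cubes; maximality gives \<open>D / (N + 1) < L / 2\<close>, the
        condition for the near vertices.\<close>
      define N where "N = nat \<lfloor>2 * D / L\<rfloor>"
      have "real k0 \<le> D / L" using LD L by (simp add: field_simps k0_def)
      moreover have "(1::real) \<le> real k0" by (simp add: k0_def)
      ultimately have DL: "real k0 \<le> D / L" "1 \<le> D / L" by linarith+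
      have "0 \<le> 2 * D / L" using D L by simp
      then have N: "real N \<le> 2 * (D / L)" "2 * (D / L) < real N + 1" by (simp_all add: N_def)
      have N0: "0 < real N" and NDL: "D / L < real N" using N DL by linarith+
      have Nk0: "real k0 \<le> real N + 1" using N DL by linarith
      have N1: "0 < N" using N0 by simp
      have N2: "D / N < L" using NDL N0 L by (simp add: field_simps)
      have N3: "D / (real N + 1) < L / 2" using N(2) L by (simp add: field_simps)
      have N4: "2 ^ d * (2 * (1 / (real N + 1))) < 1 / 32"
      proof -
        have "2 ^ d * 64 < real N + 1" using N DL by (simp add: k0_def power_add)
        then show ?thesis by (simp add: field_simps)
      qed
      have room: "ball (\<phi> (g x)) (\<mu> * \<epsilon>) \<subseteq> \<phi> ` tube W r" if "x \<in> unit_cube" "infdist (g x) W \<le> r / 2" for x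
        using \<eta>(2)[OF that] \<epsilon>\<eta> by (meson order_trans subset_ball)
      define K where "K = card {z\<in>cells N. ?G \<inter> cell_box N z \<noteq> {}}"
      let ?B = "real K * (fact d * (sqrt n * (D / N)) ^ n)"
      have "\<exists>h. continuous_on unit_cube h \<and> (\<forall>x\<in>unit_cube. norm (h x - g x) \<le> \<epsilon>) \<and>
          has_fine_covers (real n) ?B (preimage_set W h)"
        unfolding K_def D_def d
        using N2 N3 N4 nk cQ unfolding D_def d
        by (intro ex_perturbation_fine_covers[OF W ne g \<mu>(1,2) lo up \<epsilon>(1) \<epsilon>r mod room N1]) simp_all
      then obtain h where h: "continuous_on unit_cube h" "\<forall>x\<in>unit_cube. norm (h x - g x) \<le> \<epsilon>"
        "has_fine_covers (real n) ?B (preimage_set W h)" by blast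
      have "min_preimage_measure (real n) W g \<epsilon> \<le> ennreal ?B"
        using h by (intro min_preimage_measure_le[of h]) auto
      moreover have "?B \<le> C * (1 / L) ^ k"
      proof -
        have "K \<le> card (cells N :: ('d \<Rightarrow> int) set)"
          unfolding K_def by (intro card_mono finite_cells) auto
        then have "real K \<le> real N ^ d" by (simp add: card_cells d flip: of_nat_power)
        then show ?thesis
          unfolding C' using bound_by_all_cells[OF nk k D L N1] N(1) by simp
      qed
      moreover have "?B \<le> C * ((2 * L / D) ^ d * M) * (1 / L) ^ k"
      proof -
        have "2 * \<l> \<le> 2 / N" using N(1) N0 L D by (simp add: \<l>(1) field_simps)
        then have "K \<le> card \<C> * 4 ^ d"
          unfolding K_def d using \<C> by (intro card_cells_meeting_cover[OF N1]) (auto intro: order_trans)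
        then have "real K \<le> real M * 4 ^ d" unfolding \<C>(2) by (metis of_nat_le_iff of_nat_mult of_nat_numeral of_nat_power)
        moreover have "1 / real N \<le> L / D" using N2 N0 D by (simp add: field_simps)
        ultimately show ?thesis
          unfolding C' using bound_by_entropy_cells[OF nk k D L N1] by simp
      qed
      ultimately show ?thesis by (meson ennreal_leI order_trans)
    qed
    then show ?thesis by (simp add: \<Lambda> L_def[symmetric] min_def)
  qed
  moreover have "0 < \<epsilon>0" using r \<eta>(1) \<mu>(1) s0(1) \<gamma>\<mu>(2) by (simp add: \<epsilon>0_def)
  ultimately show ?thesis unfolding n_def k_def by blast
qed

end
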